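(* Let $K$ be a cubic number field whose discriminant $d_K$ is positive and fundamental (i.e. $d_K$ is the discriminant of a quadratic field). Let $L$ be a number field such that there exists an isomorphism of quadratic $\mathbb{Z}$-modules $$\langle O_K^{0}, q_K\rangle \cong \langle O_L^{0}, q_L\rangle,$$ and assume that $9 \nmid d_L$. Then $K \cong L$.
   Context: For a number field $M$ with ring of integers $O_M$ and discriminant $d_M$, the trace zero module is $O_M^{0}=\{x\in O_M : \mathrm{tr}_{M/\mathbb{Q}}(x)=0\}$, and $q_M: O_M^0\to\mathbb{Z}$ is the quadratic form $q_M(x)=\mathrm{tr}_{M/\mathbb{Q}}(x^2)$. An isomorphism of quadratic modules is a $\mathbb{Z}$-module isomorphism $O_K^0\to O_L^0$ carrying $q_K$ to $q_L$. *)

theory Defs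
  imports
    Complex_Main
    "HOL-Computational_Algebra.Polynomial"
    "Jordan_Normal_Form.Determinant"
begin

global_interpretation rat_vs: vector_space "\<lambda>(q::rat) (x::'a::field_char_0). of_rat q * x"
  by unfold_locales (simp_all add: algebra_simps of_rat_add of_rat_mult)

global_interpretation int_mod: Modules.module "\<lambda>(n::int) (x::'a::field_char_0). of_int n * x"
  by unfold_locales (simp_all add: algebra_simps)

text \<open>
  A number field is represented as a subfield, of finite dimension over the rationals, of an
  arbitrary ambient field of characteristic zero. Since \<open>inverse 0 = 0\<close>, closure under
  \<open>inverse\<close> needs no side condition.
\<close>

definition number_field :: "'a::field_char_0 set \<Rightarrow> bool" where
  "number_field M \<longleftrightarrow>
     1 \<in> M \<and> (\<forall>x\<in>M. \<forall>y\<in>M. x - y \<in> M) \<and> (\<forall>x\<in>M. \<forall>y\<in>M. x * y \<in> M) \<and>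
     (\<forall>x\<in>M. inverse x \<in> M) \<and> (\<exists>B. finite B \<and> rat_vs.span B = M)"

definition field_degree :: "'a::field_char_0 set \<Rightarrow> nat" where
  "field_degree M = rat_vs.dim M"

definition rat_basis :: "'a::field_char_0 set \<Rightarrow> 'a set \<Rightarrow> bool" where
  "rat_basis M B \<longleftrightarrow> finite B \<and> rat_vs.independent B \<and> rat_vs.span B = M"

text \<open>
  The trace of \<open>x\<close> is the trace of the rational linear map \<open>y \<mapsto> x * y\<close> on \<open>M\<close>, i.e. the sum of the
  diagonal entries of its matrix in some (equivalently, any) basis of \<open>M\<close>.
\<close>

definition field_trace :: "'a::field_char_0 set \<Rightarrow> 'a \<Rightarrow> rat" where
  "field_trace M x =
     (let B = (SOME B. rat_basis M B) in \<Sum>b\<in>B. rat_vs.representation B (x * b) b)"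

definition ring_of_integers :: "'a::field_char_0 set \<Rightarrow> 'a set" where
  "ring_of_integers M = {x \<in> M. algebraic_int x}"

definition integral_basis :: "'a::field_char_0 set \<Rightarrow> 'a list \<Rightarrow> bool" where
  "integral_basis M bs \<longleftrightarrow>
     distinct bs \<and> int_mod.independent (set bs) \<and> int_mod.span (set bs) = ring_of_integers M"

definition trace_matrix :: "'a::field_char_0 set \<Rightarrow> 'a list \<Rightarrow> rat mat" where
  "trace_matrix M bs =
     mat (length bs) (length bs) (\<lambda>(i, j). field_trace M (bs ! i * bs ! j))"

text \<open>
  The determinant below is an integer and does not depend on the integral basis, so for a number
  field the description is proper.
\<close>

definition field_discr :: "'a::field_char_0 set \<Rightarrow> int" where
  "field_discr M = (THE d. \<exists>bs. integral_basis M bs \<and> of_int d = det (trace_matrix M bs))"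

text \<open>
  Every number field embeds into the complex numbers, so it is enough to let the quadratic field
  range over subfields of \<open>complex\<close>.
\<close>

definition fundamental_discr :: "int \<Rightarrow> bool" where
  "fundamental_discr d \<longleftrightarrow>
     (\<exists>F :: complex set. number_field F \<and> field_degree F = 2 \<and> field_discr F = d)"

definition trace_zero_module :: "'a::field_char_0 set \<Rightarrow> 'a set" where
  "trace_zero_module M = {x \<in> ring_of_integers M. field_trace M x = 0}"

text \<open>On the ring of integers this form takes integer values; only its codomain is rational.\<close>

definition trace_form :: "'a::field_char_0 set \<Rightarrow> 'a \<Rightarrow> rat" where
  "trace_form M x = field_trace M (x\<^sup>2)"

definition quadratic_module_iso ::
  "'a::field_char_0 set \<Rightarrow> ('a \<Rightarrow> rat) \<Rightarrow> 'b::field_char_0 set \<Rightarrow> ('b \<Rightarrow> rat) \<Rightarrow> ('a \<Rightarrow> 'b) \<Rightarrow> bool" where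
  "quadratic_module_iso A q B r \<phi> \<longleftrightarrow>
     bij_betw \<phi> A B \<and>
     (\<forall>x\<in>A. \<forall>y\<in>A. \<phi> (x + y) = \<phi> x + \<phi> y) \<and>
     (\<forall>n::int. \<forall>x\<in>A. \<phi> (of_int n * x) = of_int n * \<phi> x) \<and>
     (\<forall>x\<in>A. r (\<phi> x) = q x)"

definition field_iso :: "'a::field_char_0 set \<Rightarrow> 'b::field_char_0 set \<Rightarrow> ('a \<Rightarrow> 'b) \<Rightarrow> bool" where
  "field_iso K L \<sigma> \<longleftrightarrow>
     bij_betw \<sigma> K L \<and> \<sigma> 1 = 1 \<and>
     (\<forall>x\<in>K. \<forall>y\<in>K. \<sigma> (x + y) = \<sigma> x + \<sigma> y \<and> \<sigma> (x * y) = \<sigma> x * \<sigma> y)"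

end

theory Submission
  imports Defs "Jordan_Normal_Form.Char_Poly"
begin

text \<open>
  Let \<open>f = a x\<^sup>3 + b x\<^sup>2 y + 3 c x y\<^sup>2 + d y\<^sup>3\<close> be the index form of \<open>O\<^sub>K\<close> in a basis adapted to the
  trace. On the trace zero module, \<open>\<beta>\<^sup>3 = Q(\<beta>) \<beta> + N(\<beta>)\<close>, where \<open>Q\<close> is half the trace form and a
  multiple of the Hessian of \<open>f\<close>, and the discriminant of this cubic is
  \<open>4 Q\<^sup>3 - 27 N\<^sup>2 = d\<^sub>K F\<^sup>2\<close> with \<open>F\<close> the restriction of \<open>f\<close>. So if an isometry preserves \<open>F\<^sup>2\<close> at a
  single \<open>\<beta> \<noteq> 0\<close>, then \<open>\<beta>\<close> and plus or minus its image have the same minimal polynomial.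

  The binary cubic forms with a prescribed primitive definite Hessian \<open>H\<close> span a rank two lattice on
  which the Hessian is a positive definite binary quadratic form times \<open>H\<close>. Two of them with the same
  Hessian have an integral inner product \<open>m\<close> with \<open>\<bar>m\<bar> \<le> 2\<close>. If \<open>\<bar>m\<bar> = 2\<close> they agree up to sign; \<open>\<bar>m\<bar> = 1\<close>
  would make \<open>d\<^sub>K\<close> a square, and \<open>m = 0\<close> would force \<open>d\<^sub>K = 12\<close>, which no cubic field has.
\<close>

section \<open>Binary cubic forms with a given Hessian\<close>

text \<open>The prime 3 shapes the proof. A trace zero vector (x, y) meets the index form as F(x, y)
  = f(3x, y), and half the trace form is H(3x, y)/3, where H is the Hessian of f. So an isometry of
  trace zero lattices is not at once an integral substitution between index forms, while uniqueness
  of a cubic with given Hessian needs that Hessian to be primitive up to a controlled factor. If 3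
  does not divide \<open>d_K\<close>, the isometry extends to the overlattice on which f lives. If 3
  divides \<open>d_K\<close>, then F/3 is integral with Hessian 9 times a primitive form, and the
  isometry acts on F/3 directly. In both cases primitivity comes from \<open>d_K\<close> being
  fundamental: a content k would leave \<open>d_K\<close> / k^2 as a smaller discriminant. That 9
  does not divide the discriminant provides a basis in which the trace zero lattice has the shape
  above; for L this is assumed, for K it follows from fundamentality. Positivity of
  \<open>d_K\<close> makes the inner product definite, which bounds m. The degree of L is not given;
  it is read off from the rank of its trace zero module.\<close>

text \<open>When A is nonzero these linear relations recover c and d from a and b, so (a, b) serve
  as coordinates on the cubic forms with Hessian A x^2 + B x y + C y^2.\<close>

lemma cubic_hessian_syzygy:
  fixes a b c d :: int
  defines "A \<equiv> b^2 - 3*a*c" and "B \<equiv> b*c - 9*a*d" and "C \<equiv> c^2 - 3*b*d"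
  shows "A*c = b*B - 3*a*C" and "3*A*d = c*B - b*C"
  unfolding A_def B_def C_def by Groebner_Basis.algebra+

text \<open>Here \<open>pA\<close>, \<open>pB\<close>, \<open>pC\<close> polarise the Hessian,
  \<open>w\<close> is the invariant alternating pairing of two binary cubics, and \<open>e\<close>
  is the determinant in the coordinates (a, b). In these coordinates A^2 is a value of the binary
  form A b^2 - 3 B a b + 9 C a^2; the last claim is the Gram determinant identity of that form, with
  \<open>e\<close> traded for \<open>w\<close>.\<close>

lemma hessian_polar:
  fixes a b c d a' b' c' d' A B C D :: int
  assumes A: "A = b^2 - 3*a*c" "A = b'^2 - 3*a'*c'"
    and B: "B = b*c - 9*a*d" "B = b'*c' - 9*a'*d'"
    and C: "C = c^2 - 3*b*d" "C = c'^2 - 3*b'*d'"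
    and D: "4*A*C - B^2 = 3*D" and A0: "A \<noteq> 0"
  defines "pA \<equiv> 2*b*b' - 3*(a*c' + a'*c)" and "pB \<equiv> b*c' + b'*c - 9*(a*d' + a'*d)"
    and "pC \<equiv> 2*c*c' - 3*(b*d' + b'*d)" and "w \<equiv> 3*(a*d' - a'*d) - (b*c' - b'*c)"
    and "e \<equiv> a*b' - a'*b"
  shows "A * pB = B * pA" and "A * pC = C * pA" and "A^2 * w = - (3*D*e)"
    and "3 * A^2 * w^2 = D * (4*A^2 - pA^2)"
proof -
  have c: "A*c = b*B - 3*a*C" "A*c' = b'*B - 3*a'*C" and d: "3*A*d = c*B - b*C" "3*A*d' = c'*B - b'*C"
    using cubic_hessian_syzygy[of b a c d, folded A(1) B(1) C(1)]
      cubic_hessian_syzygy[of b' a' c' d', folded A(2) B(2) C(2)] by auto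
  have q: "A^2 = A*b^2 - 3*B*a*b + 9*C*a^2" "A^2 = A*b'^2 - 3*B*a'*b' + 9*C*a'^2"
    using A c by Groebner_Basis.algebra+
  have pA: "A * pA = 2*A*b*b' - 3*B*(a*b' + a'*b) + 18*C*a*a'"
    unfolding pA_def using c by Groebner_Basis.algebra
  have "A * (A * pB) = A * (B * pA)"
    unfolding pA_def pB_def using c d by Groebner_Basis.algebra
  then show pB: "A * pB = B * pA" using A0 by simp
  have "A * (A * (A * pC)) = A * (A * (C * pA))"
    unfolding pA_def pC_def using c d by Groebner_Basis.algebra
  then show pC: "A * pC = C * pA" using A0 by simp
  show w: "A^2 * w = - (3*D*e)"
    unfolding w_def e_def using c d D by Groebner_Basis.algebra
  have "27*D*e^2 = 4 * A^2 * A^2 - (A*pA)^2"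
    unfolding e_def using q pA D by Groebner_Basis.algebra
  then have "A^2 * (3 * A^2 * w^2) = A^2 * (D * (4*A^2 - pA^2))"
    using w by Groebner_Basis.algebra
  then show "3 * A^2 * w^2 = D * (4*A^2 - pA^2)" using A0 by simp
qed

text \<open>The polar form is proportional to the Hessian. As the Hessian divided by n is primitive
  and n divides the polar form, the ratio m is an integer, and 3 w^2 = D (4 - m^2) leaves five
  values. The alternatives are m = \<plusmn>2 split by sign, m = \<plusmn>1, and m = 0; the last one
  also records \<open>pA = 0\<close>, from which a contradiction modulo 3 can be drawn.\<close>

lemma hessian_rigidity:
  fixes a b c d a' b' c' d' A B C D n A0 B0 C0 :: int
  assumes A: "A = b^2 - 3*a*c" "A = b'^2 - 3*a'*c'"
    and B: "B = b*c - 9*a*d" "B = b'*c' - 9*a'*d'"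
    and C: "C = c^2 - 3*b*d" "C = c'^2 - 3*b'*d'"
    and D: "4*A*C - B^2 = 3*D" and A0: "A \<noteq> 0" and D0: "D > 0"
    and n: "A = n * A0" "B = n * B0" "C = n * C0"
    and prim: "gcd A0 (gcd B0 C0) = 1"
    and dvd: "n dvd 2*b*b' - 3*(a*c' + a'*c)" "n dvd b*c' + b'*c - 9*(a*d' + a'*d)"
      "n dvd 2*c*c' - 3*(b*d' + b'*d)"
  shows "(a' = a \<and> b' = b \<and> c' = c \<and> d' = d) \<or> (a' = -a \<and> b' = -b \<and> c' = -c \<and> d' = -d)
    \<or> (3*(a*d' - a'*d) - (b*c' - b'*c))^2 = D \<or> 3 * (3*(a*d' - a'*d) - (b*c' - b'*c))^2 = 4 * D \<and> 2*b*b' = 3*(a*c' + a'*c)"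
proof -
  define pA pB pC w e where "pA = 2*b*b' - 3*(a*c' + a'*c)" and "pB = b*c' + b'*c - 9*(a*d' + a'*d)"
    and "pC = 2*c*c' - 3*(b*d' + b'*d)" and "w = 3*(a*d' - a'*d) - (b*c' - b'*c)"
    and "e = a*b' - a'*b"
  note defs = pA_def pB_def pC_def w_def e_def
  note P = hessian_polar[OF A B C D A0, folded defs]
  \<comment> \<open>Bezout coefficients for (A0, B0, C0) turn proportionality to a primitive vector
    into divisibility by A0.\<close>
  obtain x y where xy: "x * B0 + y * C0 = gcd B0 C0" using bezout_int by blast
  obtain z t where zt: "z * A0 + t * gcd B0 C0 = 1" using bezout_int prim by metis
  obtain qA qB qC where q: "pA = n * qA" "pB = n * qB" "pC = n * qC"
    using dvd unfolding defs by (metis dvdE)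
  have n0: "n \<noteq> 0" using n A0 by auto
  have "n * (n * (A0 * qB)) = n * (n * (B0 * qA))" "n * (n * (A0 * qC)) = n * (n * (C0 * qA))"
    using P(1,2) n q by Groebner_Basis.algebra+
  then have P': "A0 * qB = B0 * qA" "A0 * qC = C0 * qA" using n0 by auto
  have "qA = qA * (z * A0 + t * (x * B0 + y * C0))" using zt xy by simp
  also have "\<dots> = A0 * (z * qA + t * (x * qB + y * qC))" using P' by Groebner_Basis.algebra
  finally obtain m where "qA = A0 * m" by blast
  then have m: "pA = A * m" using q n by simp
  have "A^2 * (3 * w^2) = A^2 * (D * (4 - m^2))" using P(4) m by Groebner_Basis.algebra
  then have w: "3 * w^2 = D * (4 - m^2)" using A0 by simp
  have "D * (4 - m^2) \<ge> 0" unfolding w[symmetric] by simp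
  then have "m^2 \<le> 4" using D0 by (simp add: zero_le_mult_iff)
  then have "\<bar>m\<bar> \<le> 2" by (metis abs_le_square_iff abs_numeral power2_eq_square mult_2 numeral_Bit0)
  then have "m = -2 \<or> m = -1 \<or> m = 0 \<or> m = 1 \<or> m = 2" by arith
  then consider "m = 0" | "m^2 = 1" | s where "m = 2 * s" "s^2 = 1"
    by (metis mult.right_neutral mult_minus_right one_power2 power2_minus)
  then show ?thesis
  proof cases
    case 1
    then show ?thesis using w m unfolding defs by simp
  next
    case 2
    then show ?thesis using w unfolding defs by simp
  next
    case s: 3
    have c: "A*c = b*B - 3*a*C" "A*c' = b'*B - 3*a'*C" and d: "3*A*d = c*B - b*C" "3*A*d' = c'*B - b'*C"
      using cubic_hessian_syzygy[of b a c d, folded A(1) B(1) C(1)]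
        cubic_hessian_syzygy[of b' a' c' d', folded A(2) B(2) C(2)] by auto
    have q: "A^2 = A*b^2 - 3*B*a*b + 9*C*a^2" "A^2 = A*b'^2 - 3*B*a'*b' + 9*C*a'^2"
      using A c by Groebner_Basis.algebra+
    have pA: "A * (A * (2 * s)) = 2*A*b*b' - 3*B*(a*b' + a'*b) + 18*C*a*a'"
      using m s unfolding pA_def using c by Groebner_Basis.algebra
    \<comment> \<open>These are the coordinates of the second form minus s times the first. Equality
      in Cauchy-Schwarz gives this difference norm zero, and completing the square shows that it
      vanishes because D > 0.\<close>
    define u v where "u = a' - s * a" and "v = b' - s * b"
    have "A * v^2 - 3*B*u*v + 9*C*u^2 = 0"
      unfolding u_def v_def using q pA s(2) by Groebner_Basis.algebra
    then have "(2*A*v - 3*B*u)^2 + 27 * D * u^2 = 0" using D by Groebner_Basis.algebra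
    moreover have "(2*A*v - 3*B*u)^2 \<ge> 0" "27 * D * u^2 \<ge> 0" using D0 by auto
    ultimately have "27 * D * u^2 = 0" "(2*A*v - 3*B*u)^2 = 0" by linarith+
    then have "u = 0" "v = 0" using D0 A0 by auto
    then have ab: "a' = s * a" "b' = s * b" unfolding u_def v_def by auto
    then have "A * c' = A * (s * c)" using c by Groebner_Basis.algebra
    then have c': "c' = s * c" using A0 by simp
    have "A * d' = A * (s * d)" using d ab c' by Groebner_Basis.algebra
    then have d': "d' = s * d" using A0 by simp
    have "s = 1 \<or> s = -1" using s(2) power2_eq_1_iff by blast
    then show ?thesis using ab c' d' by auto
  qed
qed

text \<open>The primed coefficients belong to f(p x + q y, r x + s y): the Hessian is a covariant of
  weight two.\<close>

lemma hessian_covariant: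
  fixes a b c d p q r s :: int
  defines "a' \<equiv> a*p^3 + b*p^2*r + c*p*r^2 + d*r^3"
    and "b' \<equiv> 3*a*p^2*q + b*(p^2*s + 2*p*q*r) + c*(q*r^2 + 2*p*r*s) + 3*d*r^2*s"
    and "c' \<equiv> 3*a*p*q^2 + b*(q^2*r + 2*p*q*s) + c*(p*s^2 + 2*q*r*s) + 3*d*r*s^2"
    and "d' \<equiv> a*q^3 + b*q^2*s + c*q*s^2 + d*s^3"
    and "A \<equiv> b^2 - 3*a*c" and "B \<equiv> b*c - 9*a*d" and "C \<equiv> c^2 - 3*b*d"
  shows "b'^2 - 3*a'*c' = (p*s - q*r)^2 * (A*p^2 + B*p*r + C*r^2)"
    and "b'*c' - 9*a'*d' = (p*s - q*r)^2 * (2*A*p*q + B*(p*s + q*r) + 2*C*r*s)"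
    and "c'^2 - 3*b'*d' = (p*s - q*r)^2 * (A*q^2 + B*q*s + C*s^2)"
  unfolding assms by Groebner_Basis.algebra+

section \<open>Fundamental discriminants and congruences modulo 4\<close>

text \<open>An elementary form of maximality of the quadratic order: E congruent to 0 or 1 modulo 4
  means that E is again a discriminant, and k would be the index of the order of discriminant k^2 E
  in the one of discriminant E.\<close>

definition fundamental :: "int \<Rightarrow> bool" where
  "fundamental D \<longleftrightarrow> (\<forall>v. D \<noteq> v^2) \<and>
     (\<forall>k E. D = k^2 * E \<longrightarrow> E mod 4 = 0 \<or> E mod 4 = 1 \<longrightarrow> k^2 = 1)"

lemma square_mod_4: "(x::int)^2 mod 4 = 0 \<or> x^2 mod 4 = 1"
proof -
  have "x mod 4 = 0 \<or> x mod 4 = 1 \<or> x mod 4 = 2 \<or> x mod 4 = 3" by presburger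
  then show ?thesis by (auto simp: power2_eq_square mod_mult_eq[of x 4 x, symmetric])
qed

text \<open>Splitting a square off 4 A C - 3 B^2 leaves a cofactor of this shape. It is congruent to
  x^2 modulo 4, hence admissible as E in \<open>fundamental\<close>.\<close>

lemma minus_three_square_mod_4: "(4*y - 3*(x::int)^2) mod 4 = 0 \<or> (4*y - 3*x^2) mod 4 = 1"
proof -
  have "(4*y - 3*z) mod 4 = 0 \<or> (4*y - 3*z) mod 4 = 1" if "z mod 4 = 0 \<or> z mod 4 = 1" for z :: int
  proof -
    have "4*y - 3*z = z + 4*(y - z)" by simp
    then have "(4*y - 3*z) mod 4 = z mod 4" by (metis mod_mult_self2)
    then show ?thesis using that by simp
  qed
  from this[OF square_mod_4] show ?thesis .
qed

lemma not_three_dvd_square_minus: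
  fixes b :: int assumes "\<not> 3 dvd b" shows "\<not> 3 dvd b^2 - 9*x" "\<not> 3 dvd b^2 - 3*x"
proof -
  have "\<not> 3 dvd b^2" using assms by (simp add: prime_dvd_power_iff)
  then show "\<not> 3 dvd b^2 - 9*x" "\<not> 3 dvd b^2 - 3*x" by presburger+
qed

text \<open>(A, 3B, 3C) is the Hessian of the index form with coefficients (a, b, 3c, d), and the
  hypotheses \<open>Q\<close> make the matrix with columns (p, r) and (q, s) an isometry of half
  trace forms. The conclusion compares the restricted index forms only at the first basis vector and
  its image, since one generator determines the field.\<close>

lemma trace_zero_rigidity:
  fixes a b c d a' b' c' d' p q r s D :: int
  defines "A \<equiv> b^2 - 9*a*c" and "B \<equiv> b*c - 3*a*d" and "C \<equiv> 3*c^2 - b*d"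
    and "A' \<equiv> b'^2 - 9*a'*c'" and "B' \<equiv> b'*c' - 3*a'*d'" and "C' \<equiv> 3*c'^2 - b'*d'"
  assumes D: "D = 4*A*C - 3*B^2" and b: "\<not> 3 dvd b" "\<not> 3 dvd b'"
    and det: "(p*s - q*r)^2 = 1"
    and Q: "3*A'*p^2 + 3*B'*p*r + C'*r^2 = 3*A"
      "6*A'*p*q + 3*B'*(p*s + q*r) + 2*C'*r*s = 3*B"
      "3*A'*q^2 + 3*B'*q*s + C'*s^2 = C"
    and fund: "fundamental D" and D0: "D > 0" and D12: "D \<noteq> 12"
  shows "(27*a'*p^3 + 9*b'*p^2*r + 9*c'*p*r^2 + d'*r^3)^2 = (27*a)^2"
proof -
  have nsq: "D \<noteq> v^2" for v using fund unfolding fundamental_def by blast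
  have fsq: "k^2 = 1" if "D = k^2 * E" "E mod 4 = 0 \<or> E mod 4 = 1" for k E
    using fund[unfolded fundamental_def, THEN conjunct2, rule_format, OF that] .
  have A3: "\<not> 3 dvd A" "\<not> 3 dvd A'"
    unfolding A_def A'_def using not_three_dvd_square_minus(1) b by (metis mult.assoc)+
  then have A0: "A \<noteq> 0" by auto
  have D': "D = 4*A'*C' - 3*B'^2"
  proof -
    have "9 * D = (p*s - q*r)^2 * (9 * (4*A'*C' - 3*B'^2))"
      using D Q by Groebner_Basis.algebra
    then show ?thesis using det by simp
  qed
  show ?thesis
  proof (cases "3 dvd D")
    case False
    then have "\<not> 3 dvd C'" using D' by (metis dvd_diff dvd_mult dvd_triv_left)
    moreover have "C' * r^2 = 3 * (A - A'*p^2 - B'*p*r)" using Q(1) by Groebner_Basis.algebra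
    then have "3 dvd C' * r^2" by simp
    ultimately have "3 dvd r"
      by (simp add: prime_dvd_mult_iff prime_dvd_power_iff)
    then obtain r1 where r: "r = 3 * r1" by blast
    \<comment> \<open>With r = 3 r1 the isometry becomes integral in the index form coordinates (3x,
      y), with columns (p, r1) and (3q, s). These are the coefficients of the second index form
      after that substitution.\<close>
    define a1 b1 c1 d1 where
      "a1 = a'*p^3 + b'*p^2*r1 + (3*c')*p*r1^2 + d'*r1^3"
      and "b1 = 3*a'*p^2*(3*q) + b'*(p^2*s + 2*p*(3*q)*r1) + (3*c')*((3*q)*r1^2 + 2*p*r1*s) + 3*d'*r1^2*s"
      and "c1 = 3*a'*p*(3*q)^2 + b'*((3*q)^2*r1 + 2*p*(3*q)*s) + (3*c')*(p*s^2 + 2*(3*q)*r1*s) + 3*d'*r1*s^2"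
      and "d1 = a'*(3*q)^3 + b'*(3*q)^2*s + (3*c')*(3*q)*s^2 + d'*s^3"
    note f1 = a1_def b1_def c1_def d1_def
    have det1: "(p*s - 3*q*r1)^2 = 1" using det r by (simp add: mult_ac)
    note cov = hessian_covariant[where a = a' and b = b' and c = "3*c'" and d = d' and p = p and q = "3*q" and r = r1 and s = s,
        folded f1, unfolded det1]
    have e1: "b^2 - 3*a*(3*c) = A" "b*(3*c) - 9*a*d = 3*B" "(3*c)^2 - 3*b*d = 3*C"
      unfolding A_def B_def C_def by Groebner_Basis.algebra+
    have Hc: "b1^2 - 3*a1*c1 = A" "b1*c1 - 9*a1*d1 = 3*B" "c1^2 - 3*b1*d1 = 3*C"
    proof -
      have "3 * (b1^2 - 3*a1*c1) = 3 * A" using cov(1) Q(1) r unfolding A'_def B'_def C'_def by Groebner_Basis.algebra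
      then show "b1^2 - 3*a1*c1 = A" by simp
      show "b1*c1 - 9*a1*d1 = 3*B" using cov(2) Q(2) r unfolding A'_def B'_def C'_def by Groebner_Basis.algebra
      show "c1^2 - 3*b1*d1 = 3*C" using cov(3) Q(3) r unfolding A'_def B'_def C'_def by Groebner_Basis.algebra
    qed
    have prim: "gcd A (gcd (3*B) (3*C)) = 1"
    proof -
      \<comment> \<open>The content k divides A, so it is prime to 3 and divides B and C as well.
        Then D is k^2 times a discriminant, and fundamentality gives k = 1.\<close>
      define k where "k = gcd A (gcd (3*B) (3*C))"
      have k: "k dvd A" "k dvd 3*B" "k dvd 3*C" unfolding k_def by (meson gcd_dvd1 gcd_dvd2 dvd_trans)+
      have "\<not> 3 dvd k" using k(1) A3 dvd_trans by blast
      then have "coprime 3 k" by (simp add: prime_imp_coprime)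
      then have "coprime k 3" by (simp add: coprime_commute)
      then have "k dvd B" "k dvd C" using k by (simp_all add: coprime_dvd_mult_right_iff)
      then obtain x y z where "A = k * x" "B = k * y" "C = k * z" using k(1) by blast
      then have "D = k^2 * (4*(x*z) - 3*y^2)" using D by Groebner_Basis.algebra
      then have "k^2 = 1" using fsq minus_three_square_mod_4 by blast
      moreover have "k \<ge> 0" unfolding k_def by simp
      ultimately show ?thesis unfolding k_def[symmetric] by (simp add: power2_eq_1_iff)
    qed
    have n1: "A = 1 * A" "3*B = 1 * (3*B)" "3*C = 1 * (3*C)" by simp_all
    have "4*A*(3*C) - (3*B)^2 = 3*D" using D by Groebner_Basis.algebra
    from hessian_rigidity[OF e1(1)[symmetric] Hc(1)[symmetric] e1(2)[symmetric] Hc(2)[symmetric]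
        e1(3)[symmetric] Hc(3)[symmetric] this A0 D0 n1 prim one_dvd one_dvd one_dvd]
    have "a1 = a \<or> a1 = -a \<or> 2*b*b1 = 3*(a*c1 + a1*(3*c))"
      using nsq by blast
    \<comment> \<open>Orthogonality (m = 0) is impossible modulo 3: it would make b1, and with it A,
      divisible by 3.\<close>
    moreover have False if "2*b*b1 = 3*(a*c1 + a1*(3*c))"
    proof -
      have "3 dvd 2*(b*b1)" using that by (metis dvd_triv_left mult.assoc)
      then have "3 dvd b*b1" by presburger
      then have "3 dvd b1" using b by (simp add: prime_dvd_mult_iff)
      then have "3 dvd A" unfolding Hc(1)[symmetric] by (simp add: power2_eq_square mult.assoc)
      then show False using A3 by blast
    qed
    ultimately have "a1^2 = a^2" by auto
    moreover have "27*a'*p^3 + 9*b'*p^2*r + 9*c'*p*r^2 + d'*r^3 = 27 * a1"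
      unfolding a1_def r by Groebner_Basis.algebra
    ultimately show ?thesis by (simp add: power_mult_distrib)
  next
    case True
    have CC: "3 dvd y" if "D = 4*x*y - 3*z^2" "\<not> 3 dvd x" for x y z :: int
    proof -
      have "x * y = D - 3*(x*y - z^2)" using that(1) by Groebner_Basis.algebra
      then have "3 dvd x * y" using True by (metis dvd_diff dvd_triv_left)
      then show ?thesis using that(2) by (simp add: prime_dvd_mult_iff)
    qed
    have "3 dvd C" "3 dvd C'" using CC D D' A3 by blast+
    then obtain C2 C2' where C2: "C = 3 * C2" "C' = 3 * C2'" by blast
    then have "3 dvd b * d" "3 dvd b' * d'" unfolding C_def C'_def by presburger+
    then have "3 dvd d" "3 dvd d'" using b by (simp_all add: prime_dvd_mult_iff)
    then obtain d2 d2' where d2: "d = 3 * d2" "d' = 3 * d2'" by (elim dvdE)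
    \<comment> \<open>Since 3 divides d, one third of the restricted index form is integral, with
      coefficients (9a, 3b, 3c, d2) and Hessian 9 (A, B, C2). The substitution is now the isometry
      itself. The thirds b0 and c0 of the middle coefficients are what makes the polar form
      divisible by 9.\<close>
    define a1 b1 c1 d1 b0 c0 where
      "a1 = (9*a')*p^3 + (3*b')*p^2*r + (3*c')*p*r^2 + d2'*r^3"
      and "b1 = 3*(9*a')*p^2*q + (3*b')*(p^2*s + 2*p*q*r) + (3*c')*(q*r^2 + 2*p*r*s) + 3*d2'*r^2*s"
      and "c1 = 3*(9*a')*p*q^2 + (3*b')*(q^2*r + 2*p*q*s) + (3*c')*(p*s^2 + 2*q*r*s) + 3*d2'*r*s^2"
      and "d1 = (9*a')*q^3 + (3*b')*q^2*s + (3*c')*q*s^2 + d2'*s^3"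
      and "b0 = (9*a')*p^2*q + b'*(p^2*s + 2*p*q*r) + c'*(q*r^2 + 2*p*r*s) + d2'*r^2*s"
      and "c0 = (9*a')*p*q^2 + b'*(q^2*r + 2*p*q*s) + c'*(p*s^2 + 2*q*r*s) + d2'*r*s^2"
    note f1 = a1_def b1_def c1_def d1_def
    have b1: "b1 = 3 * b0" and c1: "c1 = 3 * c0" unfolding b1_def b0_def c1_def c0_def by (simp_all add: algebra_simps)
    note cov = hessian_covariant[where a = "9*a'" and b = "3*b'" and c = "3*c'" and d = d2' and p = p and q = q and r = r and s = s,
        folded f1, unfolded det]
    have e1: "(3*b)^2 - 3*(9*a)*(3*c) = 9*A" "(3*b)*(3*c) - 9*(9*a)*d2 = 9*B" "(3*c)^2 - 3*(3*b)*d2 = 9*C2"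
    proof -
      show "(3*b)^2 - 3*(9*a)*(3*c) = 9*A" "(3*b)*(3*c) - 9*(9*a)*d2 = 9*B"
        unfolding A_def B_def d2 by (simp_all add: power2_eq_square algebra_simps)
      show "(3*c)^2 - 3*(3*b)*d2 = 9*C2" using C2(1) d2(1) unfolding C_def by Groebner_Basis.algebra
    qed
    have Hc: "b1^2 - 3*a1*c1 = 9*A" "b1*c1 - 9*a1*d1 = 9*B" "c1^2 - 3*b1*d1 = 9*C2"
    proof -
      show "b1^2 - 3*a1*c1 = 9*A"
        using cov(1) Q(1) d2(2) unfolding A'_def B'_def C'_def by Groebner_Basis.algebra
      show "b1*c1 - 9*a1*d1 = 9*B" using cov(2) Q(2) d2(2) unfolding A'_def B'_def C'_def by Groebner_Basis.algebra
      show "c1^2 - 3*b1*d1 = 9*C2" using cov(3) Q(3) d2(2) C2(1) unfolding A'_def B'_def C'_def by Groebner_Basis.algebra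
    qed
    have prim: "gcd A (gcd B C2) = 1"
    proof -
      define k where "k = gcd A (gcd B C2)"
      have "k dvd A" "k dvd B" "k dvd C2" unfolding k_def by (meson gcd_dvd1 gcd_dvd2 dvd_trans)+
      then obtain x y z where "A = k * x" "B = k * y" "C2 = k * z" by blast
      then have "D = k^2 * (4*(3*x*z) - 3*y^2)" using D C2 by Groebner_Basis.algebra
      then have "k^2 = 1" using fsq minus_three_square_mod_4 by blast
      moreover have "k \<ge> 0" unfolding k_def by simp
      ultimately show ?thesis unfolding k_def[symmetric] by (simp add: power2_eq_1_iff)
    qed
    have A9: "9*A \<noteq> 0" and D9: "9*D > 0" using A0 D0 by auto
    have disc: "4*(9*A)*(9*C2) - (9*B)^2 = 3*(9*D)" using D C2 by Groebner_Basis.algebra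
    define w where "w = 9*a*d1 - a1*d2 - 3*(b*c0 - b0*c)"
    have w: "3*(9*a*d1 - a1*d2) - (3*b*c1 - b1*(3*c)) = 3 * w" unfolding w_def b1 c1 by Groebner_Basis.algebra
    have dvd: "9 dvd 2*(3*b)*b1 - 3*(9*a*c1 + a1*(3*c))" "9 dvd 3*b*c1 + b1*(3*c) - 9*(9*a*d1 + a1*d2)"
      "9 dvd 2*(3*c)*c1 - 3*(3*b*d1 + b1*d2)"
    proof -
      have "2*(3*b)*b1 - 3*(9*a*c1 + a1*(3*c)) = 9 * (2*b*b0 - 9*a*c0 - a1*c)"
        "3*b*c1 + b1*(3*c) - 9*(9*a*d1 + a1*d2) = 9 * (b*c0 + b0*c - 9*a*d1 - a1*d2)"
        "2*(3*c)*c1 - 3*(3*b*d1 + b1*d2) = 9 * (2*c*c0 - b*d1 - b0*d2)"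
        unfolding b1 c1 by (simp_all add: algebra_simps)
      then show "9 dvd 2*(3*b)*b1 - 3*(9*a*c1 + a1*(3*c))" "9 dvd 3*b*c1 + b1*(3*c) - 9*(9*a*d1 + a1*d2)"
      "9 dvd 2*(3*c)*c1 - 3*(3*b*d1 + b1*d2)" by (metis dvd_triv_left)+
    qed
    from hessian_rigidity[OF e1(1)[symmetric] Hc(1)[symmetric] e1(2)[symmetric] Hc(2)[symmetric]
        e1(3)[symmetric] Hc(3)[symmetric] disc A9 D9 refl refl refl prim dvd, unfolded w]
    have "a1 = 9*a \<or> a1 = -(9*a) \<or> (3*w)^2 = 9*D \<or> 3*(3*w)^2 = 4*(9*D)"
      by argo
    moreover have False if "(3*w)^2 = 9*D" using that nsq[of w] by (simp add: power_mult_distrib)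
    \<comment> \<open>Orthogonality gives 3 w^2 = 4 D, so D = 3 v^2 with w = 2 v. As D is 0 or 1
      modulo 4, v is even, hence D = 12 t^2 and fundamentality gives t^2 = 1. This is where the
      exception 12 comes from.\<close>
    moreover have False if "3*(3*w)^2 = 4*(9*D)"
    proof -
      have w: "3*w^2 = 4*D" using that by (simp add: power_mult_distrib)
      then have "even (3 * w^2)" by simp
      then have "even (w^2)" by simp
      then obtain v where v: "w = 2 * v" by auto
      then have Dv: "D = 3 * v^2" using w by (simp add: power_mult_distrib)
      have "D mod 4 = 0 \<or> D mod 4 = 1"
        unfolding D using minus_three_square_mod_4[of "A*C" B] by (simp add: mult.assoc)
      then have "even y" if "D = 3 * y" "y mod 4 = 0 \<or> y mod 4 = 1" for y
      proof -
        have "y mod 4 \<noteq> 1"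
        proof
          assume "y mod 4 = 1"
          then have "(3 * y) mod 4 = 3" using mod_mult_right_eq[of 3 y 4] by simp
          then show False using \<open>D mod 4 = 0 \<or> D mod 4 = 1\<close> that(1) by simp
        qed
        then have "4 dvd y" using that(2) by (simp add: mod_eq_0_iff_dvd)
        moreover have "even (4::int)" by simp
        ultimately show ?thesis by (rule dvd_trans[rotated])
      qed
      from this[OF Dv square_mod_4] have "even (v^2)" .
      then obtain t where t: "v = 2 * t" by auto
      then have "D = t^2 * 12" using Dv by Groebner_Basis.algebra
      moreover have "t^2 = 1" by (rule fsq[OF \<open>D = t^2 * 12\<close>]) simp
      ultimately show False using D12 by simp
    qed
    ultimately have "a1^2 = (9*a)^2" by auto
    moreover have "27*a'*p^3 + 9*b'*p^2*r + 9*c'*p*r^2 + d'*r^3 = 3 * a1"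
      unfolding a1_def d2 by Groebner_Basis.algebra
    ultimately show ?thesis by (simp add: power_mult_distrib)
  qed
qed

section \<open>Positive definite binary quadratic forms of discriminant -4\<close>

text \<open>Gauss reduction: while a diagonal coefficient is below 2 |k|, a shear by the sign of k
  lowers |k|. When neither is, 4 k^2 \<le> k^2 + 1 forces k = 0 and A = 1.\<close>

lemma disc_minus_four_represents_one:
  fixes A C k :: int
  assumes "A > 0" "C > 0" "A * C = k^2 + 1"
  shows "\<exists>x y. A*x^2 + 2*k*x*y + C*y^2 = 1"
  using assms
proof (induction "nat \<bar>k\<bar>" arbitrary: A C k rule: less_induct)
  case less
  \<comment> \<open>The sign of k, set to 1 at k = 0 so that its square is always 1.\<close>
  define \<epsilon> where "\<epsilon> = (if k \<ge> 0 then 1 else -1 :: int)"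
  have e: "\<epsilon>^2 = 1" "\<epsilon> * k = \<bar>k\<bar>" unfolding \<epsilon>_def by auto
  consider "A < 2*\<bar>k\<bar>" | "C < 2*\<bar>k\<bar>" | "2*\<bar>k\<bar> \<le> A" "2*\<bar>k\<bar> \<le> C" by linarith
  then show ?case
  proof cases
    case 1
    have lt: "nat \<bar>k - \<epsilon>*A\<bar> < nat \<bar>k\<bar>" using 1 less.prems(1) unfolding \<epsilon>_def by auto
    have eq: "A * (C - 2*\<epsilon>*k + A) = (k - \<epsilon>*A)^2 + 1" using less.prems(3) e(1) by Groebner_Basis.algebra
    then have "A * (C - 2*\<epsilon>*k + A) > 0" by (simp add: add_nonneg_pos)
    then have "C - 2*\<epsilon>*k + A > 0" using less.prems(1) by (simp add: zero_less_mult_iff)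
    from less.hyps[OF lt less.prems(1) this eq]
    obtain x y where "A*x^2 + 2*(k - \<epsilon>*A)*x*y + (C - 2*\<epsilon>*k + A)*y^2 = 1" by blast
    then have "A*(x - \<epsilon>*y)^2 + 2*k*(x - \<epsilon>*y)*y + C*y^2 = 1" using e(1) by Groebner_Basis.algebra
    then show ?thesis by blast
  next
    case 2
    have lt: "nat \<bar>k - \<epsilon>*C\<bar> < nat \<bar>k\<bar>" using 2 less.prems(2) unfolding \<epsilon>_def by auto
    have eq: "(A - 2*\<epsilon>*k + C) * C = (k - \<epsilon>*C)^2 + 1" using less.prems(3) e(1) by Groebner_Basis.algebra
    then have "(A - 2*\<epsilon>*k + C) * C > 0" by (simp add: add_nonneg_pos)
    then have "A - 2*\<epsilon>*k + C > 0" using less.prems(2) by (simp add: zero_less_mult_iff)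
    from less.hyps[OF lt this less.prems(2) eq]
    obtain x y where "(A - 2*\<epsilon>*k + C)*x^2 + 2*(k - \<epsilon>*C)*x*y + C*y^2 = 1" by blast
    then have "A*x^2 + 2*k*x*(y - \<epsilon>*x) + C*(y - \<epsilon>*x)^2 = 1" using e(1) by Groebner_Basis.algebra
    then show ?thesis by blast
  next
    case 3
    then have "(2*\<bar>k\<bar>) * (2*\<bar>k\<bar>) \<le> A * C" by (intro mult_mono) auto
    then have "4*k^2 \<le> k^2 + 1" using less.prems(3) by (simp add: power2_eq_square flip: abs_mult)
    then have "k^2 = 0" using zero_le_power2[of k] by linarith
    then have "A * C = 1" using less.prems(3) by simp
    then have "A = 1" using less.prems(1) by (simp add: zmult_eq_1_iff)
    then show ?thesis by (intro exI[of _ 1] exI[of _ 0]) simp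
  qed
qed

section \<open>Traces and lattices in number fields\<close>

lemma number_fieldD:
  assumes "number_field M"
  shows number_field_subspace: "rat_vs.subspace M"
    and number_field_one: "1 \<in> M"
    and number_field_mult: "x \<in> M \<Longrightarrow> y \<in> M \<Longrightarrow> x * y \<in> M"
    and number_field_inverse: "x \<in> M \<Longrightarrow> inverse x \<in> M"
  using assms unfolding number_field_def by (auto intro: rat_vs.subspace_span)

lemma number_field_add: "number_field M \<Longrightarrow> x \<in> M \<Longrightarrow> y \<in> M \<Longrightarrow> x + y \<in> M"
  and number_field_scale: "number_field M \<Longrightarrow> x \<in> M \<Longrightarrow> of_rat q * x \<in> M"
  using rat_vs.subspace_add rat_vs.subspace_scale number_field_subspace by blast+

lemma number_field_of_rat: "number_field M \<Longrightarrow> of_rat q \<in> M"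
  using number_field_scale[of M 1 q] number_field_one by auto

lemma number_field_int_subspace: "number_field M \<Longrightarrow> int_mod.subspace M"
  using number_field_subspace[of M] number_field_scale[of M _ "of_int _"]
  unfolding int_mod.subspace_def rat_vs.subspace_def by auto

lemma rat_basis_exists:
  assumes "number_field M" obtains B where "rat_basis M B"
proof -
  from assms obtain B where B: "finite B" "rat_vs.span B = M" unfolding number_field_def by blast
  obtain C where C: "C \<subseteq> B" "rat_vs.independent C" "B \<subseteq> rat_vs.span C"
    using rat_vs.maximal_independent_subset[of B] by blast
  have "rat_vs.span C = rat_vs.span B"
    using rat_vs.span_mono[OF C(1)] rat_vs.span_minimal[OF C(3) rat_vs.subspace_span] by (rule subset_antisym)
  then have "rat_basis M C" using B C finite_subset unfolding rat_basis_def by auto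
  then show ?thesis using that by blast
qed

lemma rat_basisD:
  assumes "rat_basis M B"
  shows "finite B" "rat_vs.independent B" "rat_vs.span B = M" "B \<subseteq> M"
  using assms rat_vs.span_superset unfolding rat_basis_def by auto

lemma card_rat_basis: "rat_basis M B \<Longrightarrow> card B = field_degree M"
  unfolding field_degree_def rat_basis_def using rat_vs.dim_span_eq_card_independent by metis

text \<open>Expanding \<open>x * b\<close> in C and \<open>c\<close> in B turns both sides into the
  same double sum, as in tr(P Q) = tr(Q P).\<close>

lemma trace_basis_independent:
  assumes M: "number_field M" and B: "rat_basis M B" and C: "rat_basis M C" and x: "x \<in> M"
  shows "(\<Sum>b\<in>B. rat_vs.representation B (x * b) b) = (\<Sum>c\<in>C. rat_vs.representation C (x * c) c)"
proof -
  note Bs = rat_basisD[OF B] and Cs = rat_basisD[OF C]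
  let ?rB = "rat_vs.representation B" and ?rC = "rat_vs.representation C"
  have "?rB (x * b) b = (\<Sum>c\<in>C. ?rC (x * b) c * ?rB c b)" if "b \<in> B" for b
  proof -
    have "x * b \<in> M" using M x that Bs(4) number_field_mult by blast
    then have "x * b = (\<Sum>c\<in>C. of_rat (?rC (x * b) c) * c)"
      using rat_vs.sum_representation_eq[OF Cs(2) _ Cs(1) subset_refl] Cs(3) by simp
    then have "?rB (x * b) b = ?rB (\<Sum>c\<in>C. of_rat (?rC (x * b) c) * c) b" by simp
    also have "\<dots> = (\<Sum>c\<in>C. ?rB (of_rat (?rC (x * b) c) * c) b)"
      using Bs(2,3) Cs(4) number_field_scale[OF M] by (subst rat_vs.representation_sum) auto
    also have "\<dots> = (\<Sum>c\<in>C. ?rC (x * b) c * ?rB c b)"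
      using Bs(2,3) Cs(4) by (intro sum.cong refl) (subst rat_vs.representation_scale, auto)
    finally show ?thesis .
  qed
  then have "(\<Sum>b\<in>B. ?rB (x * b) b) = (\<Sum>b\<in>B. \<Sum>c\<in>C. ?rC (x * b) c * ?rB c b)"
    by (intro sum.cong) auto
  also have "\<dots> = (\<Sum>c\<in>C. \<Sum>b\<in>B. ?rB c b * ?rC (x * b) c)"
    by (subst sum.swap) (simp add: mult.commute)
  also have "\<dots> = (\<Sum>c\<in>C. ?rC (x * c) c)"
  proof (intro sum.cong refl)
    fix c assume c: "c \<in> C"
    then have cM: "c \<in> M" using Cs by blast
    have "x * c = x * (\<Sum>b\<in>B. of_rat (?rB c b) * b)"
      using rat_vs.sum_representation_eq[OF Bs(2) _ Bs(1) subset_refl] Bs(3) cM by simp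
    also have "\<dots> = (\<Sum>b\<in>B. of_rat (?rB c b) * (x * b))"
      by (simp add: sum_distrib_left mult_ac)
    finally have "?rC (x * c) c = ?rC (\<Sum>b\<in>B. of_rat (?rB c b) * (x * b)) c" by simp
    also have "\<dots> = (\<Sum>b\<in>B. ?rC (of_rat (?rB c b) * (x * b)) c)"
      using Cs(2,3) Bs(4) number_field_scale[OF M] number_field_mult[OF M x]
      by (subst rat_vs.representation_sum) auto
    also have "\<dots> = (\<Sum>b\<in>B. ?rB c b * ?rC (x * b) c)"
      using Cs(2,3) Bs(4) number_field_mult[OF M x]
      by (intro sum.cong refl) (subst rat_vs.representation_scale, auto)
    finally show "(\<Sum>b\<in>B. ?rB c b * ?rC (x * b) c) = ?rC (x * c) c" by simp
  qed
  finally show ?thesis .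
qed

lemma field_trace_eq:
  assumes "number_field M" "rat_basis M B" "x \<in> M"
  shows "field_trace M x = (\<Sum>b\<in>B. rat_vs.representation B (x * b) b)"
proof -
  have "rat_basis M (SOME B. rat_basis M B)" using assms(2) by (rule someI)
  from trace_basis_independent[OF assms(1) this assms(2,3)]
  show ?thesis unfolding field_trace_def Let_def .
qed

lemma field_trace_add:
  assumes M: "number_field M" and "x \<in> M" "y \<in> M"
  shows "field_trace M (x + y) = field_trace M x + field_trace M y"
proof -
  obtain B where B: "rat_basis M B" using rat_basis_exists[OF M] .
  note Bs = rat_basisD[OF B]
  have "rat_vs.representation B ((x + y) * b) b =
      rat_vs.representation B (x * b) b + rat_vs.representation B (y * b) b" if "b \<in> B" for b
  proof -
    have "x * b \<in> M" "y * b \<in> M" using that assms number_field_mult[OF M] Bs(4) by blast+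
    then show ?thesis
      using rat_vs.representation_add[OF Bs(2)] Bs(3) by (simp add: distrib_right)
  qed
  then show ?thesis
    using assms number_field_add[OF M] by (simp add: field_trace_eq[OF M B] sum.distrib)
qed

lemma field_trace_scale:
  assumes M: "number_field M" and "x \<in> M"
  shows "field_trace M (of_rat q * x) = q * field_trace M x"
proof -
  obtain B where B: "rat_basis M B" using rat_basis_exists[OF M] .
  note Bs = rat_basisD[OF B]
  have "rat_vs.representation B (of_rat q * x * b) b = q * rat_vs.representation B (x * b) b"
    if "b \<in> B" for b
    using that assms number_field_mult[OF M] Bs
    by (subst mult.assoc, subst rat_vs.representation_scale) auto
  then show ?thesis
    using assms number_field_scale[OF M] by (simp add: field_trace_eq[OF M B] sum_distrib_left)
qed

lemma field_trace_one:
  assumes M: "number_field M" shows "field_trace M 1 = of_nat (field_degree M)"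
proof -
  obtain B where B: "rat_basis M B" using rat_basis_exists[OF M] .
  note Bs = rat_basisD[OF B]
  show ?thesis using number_field_one[OF M] card_rat_basis[OF B]
    by (simp add: field_trace_eq[OF M B] rat_vs.representation_basis[OF Bs(2)])
qed

lemma field_trace_sum:
  assumes M: "number_field M" and "\<And>i. i \<in> I \<Longrightarrow> f i \<in> M"
  shows "field_trace M (\<Sum>i\<in>I. f i) = (\<Sum>i\<in>I. field_trace M (f i))"
proof -
  have z: "0 \<in> M" using rat_vs.subspace_0[OF number_field_subspace[OF M]] .
  have "field_trace M 0 = 0" using field_trace_scale[OF M z, of 0] by simp
  then show ?thesis using assms(2)
    by (induction I rule: infinite_finite_induct)
      (auto simp: field_trace_add[OF M] rat_vs.subspace_sum[OF number_field_subspace[OF M]])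
qed

lemma field_degree_pos: assumes M: "number_field M" shows "field_degree M > 0"
proof -
  obtain B where B: "rat_basis M B" using rat_basis_exists[OF M] .
  have "B \<noteq> {}" using rat_basisD[OF B] number_field_one[OF M] by auto
  then show ?thesis using card_rat_basis[OF B] rat_basisD(1)[OF B] by (metis card_gt_0_iff)
qed

text \<open>One step of the Euclidean algorithm on the coefficients of \<open>y\<close> replaces a generator \<open>j\<close> by
  \<open>j \<plusminus> i\<close>; it ends when at most one coefficient is left.\<close>

lemma int_span_reduce:
  fixes G :: "'a::field_char_0 set" and u :: "'a \<Rightarrow> int"
  assumes "finite G" and "\<exists>g\<in>G. u g \<noteq> 0"
  shows "\<exists>G'. finite G' \<and> int_mod.span G' = int_mod.span G \<and> card G' \<le> card G \<and>
    (card G' < card G \<or> (\<exists>b\<in>G'. \<exists>n. n \<noteq> 0 \<and> (\<Sum>g\<in>G. of_int (u g) * g) = of_int n * b))"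
  using assms
proof (induction "\<Sum>g\<in>G. nat \<bar>u g\<bar>" arbitrary: G u rule: less_induct)
  case less
  show ?case
  proof (cases "\<exists>i\<in>G. \<exists>j\<in>G. i \<noteq> j \<and> u i \<noteq> 0 \<and> u j \<noteq> 0")
    case False
    obtain b where b: "b \<in> G" "u b \<noteq> 0" using less.prems by blast
    have "u g = 0" if "g \<in> G - {b}" for g using False b that by blast
    then have "(\<Sum>g\<in>G. of_int (u g) * g) = of_int (u b) * b"
      by (simp add: sum.remove[OF less.prems(1) b(1)])
    then show ?thesis using b less.prems(1) by blast
  next
    case True
    then obtain i j where ij: "i \<in> G" "j \<in> G" "i \<noteq> j" "u i \<noteq> 0" "u j \<noteq> 0" "\<bar>u j\<bar> \<le> \<bar>u i\<bar>"
      by (metis linear)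
    define H where "H = G - {i, j}"
    have H: "finite H" "i \<notin> H" "j \<notin> H" "G = insert i (insert j H)"
      using ij less.prems(1) unfolding H_def by auto
    define s where "s = sgn (u i) * sgn (u j)"
    have s: "s = 1 \<or> s = -1" using ij unfolding s_def by (auto simp: sgn_if)
    have lt: "\<bar>u i - s * u j\<bar> + \<bar>u j\<bar> < \<bar>u i\<bar> + \<bar>u j\<bar>"
      using ij unfolding s_def by (auto simp: sgn_if)
    define h where "h = j + of_int s * i"
    have j: "j = h - of_int s * i" unfolding h_def by simp
    define G1 where "G1 = insert i (insert h H)"
    have "h \<in> int_mod.span G"
      unfolding h_def using ij(1,2) by (intro int_mod.span_add int_mod.span_scale int_mod.span_base)
    then have G1: "G1 \<subseteq> int_mod.span G"
      unfolding G1_def using H(4) by (auto intro: int_mod.span_base)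
    have "j \<in> int_mod.span G1"
      unfolding j G1_def by (intro int_mod.span_diff int_mod.span_scale int_mod.span_base) auto
    then have "G \<subseteq> int_mod.span G1"
      unfolding H(4) by (auto simp: G1_def intro: int_mod.span_base)
    with G1 have span: "int_mod.span G1 = int_mod.span G" by (simp add: int_mod.span_eq)
    have fin: "finite G1" unfolding G1_def using H by simp
    \<comment> \<open>The new generator h may already be present. Then the generating set shrinks,
      which is why the conclusion offers a smaller set as an alternative.\<close>
    show ?thesis
    proof (cases "h \<in> insert i H")
      case True
      then have "G1 = insert i H" unfolding G1_def by auto
      then have "card G1 < card G" unfolding H(4) using H(1-3) ij(3) by simp
      then show ?thesis using span fin by (metis less_imp_le)
    next
      case False
      then have hi: "i \<noteq> h" "h \<notin> H" by auto
      define v where "v = u(i := u i - s * u j, h := u j)"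
      have v: "v i = u i - s * u j" "v h = u j" "\<And>g. g \<in> H \<Longrightarrow> v g = u g"
        using hi H(2) unfolding v_def by auto
      have card: "card G1 = card G" unfolding G1_def H(4) using hi H(1-3) ij(3) by simp
      have vH: "(\<Sum>g\<in>H. of_int (v g) * g) = (\<Sum>g\<in>H. of_int (u g) * g)"
        "(\<Sum>g\<in>H. nat \<bar>v g\<bar>) = (\<Sum>g\<in>H. nat \<bar>u g\<bar>)"
        using v(3) by (auto intro!: sum.cong)
      have sum: "(\<Sum>g\<in>G1. of_int (v g) * g) = (\<Sum>g\<in>G. of_int (u g) * g)"
        unfolding G1_def H(4) using hi H(1-3) ij(3) by (simp add: v vH) (simp add: h_def algebra_simps)
      have m: "(\<Sum>g\<in>G1. nat \<bar>v g\<bar>) < (\<Sum>g\<in>G. nat \<bar>u g\<bar>)"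
        unfolding G1_def H(4) using hi H(1-3) ij(3) lt by (simp add: v vH)
      have "\<exists>g\<in>G1. v g \<noteq> 0" using v(2) ij(5) unfolding G1_def by auto
      from less.hyps[OF m fin this] show ?thesis unfolding span card sum .
    qed
  qed
qed

lemma int_span_basis:
  fixes G :: "'a::field_char_0 set"
  assumes "finite G"
  obtains B where "finite B" "int_mod.independent B" "int_mod.span B = int_mod.span G"
proof -
  let ?P = "\<lambda>B. finite B \<and> int_mod.span B = int_mod.span G"
  obtain B where B: "?P B" and least: "\<And>B'. ?P B' \<Longrightarrow> card B \<le> card B'"
    using ex_has_least_nat[of ?P G card] assms by blast
  have "int_mod.independent B"
  proof
    assume "int_mod.dependent B"
    then obtain u where u: "\<exists>b\<in>B. u b \<noteq> 0" "(\<Sum>b\<in>B. of_int (u b) * b) = 0"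
      using int_mod.dependent_finite B by blast
    from int_span_reduce[of B u] B u obtain G' where G': "?P G'" "card G' \<le> card B"
      and "card G' < card B \<or> (\<exists>b\<in>G'. \<exists>n. n \<noteq> 0 \<and> 0 = of_int n * b)" by auto
    moreover have "\<not> card G' < card B" using least[OF G'(1)] by simp
    ultimately have "0 \<in> G'" by auto
    have "0 \<in> int_mod.span (G' - {0})" by (rule int_mod.span_zero)
    then have "int_mod.span (G' - {0}) = int_mod.span G'"
      by (auto simp: int_mod.span_eq intro: int_mod.span_base)
    then have "card B \<le> card (G' - {0})" using least G'(1) by simp
    then show False using G' \<open>0 \<in> G'\<close> by (metis card_Diff1_less leD order_less_le_trans)
  qed
  then show ?thesis using that B by blast
qed

lemma common_denominator:
  fixes q :: "'b \<Rightarrow> rat"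
  assumes "finite I"
  shows "\<exists>N::int. N > 0 \<and> (\<forall>i\<in>I. \<exists>k. of_int N * q i = of_int k)"
  using assms
proof induction
  case empty
  then show ?case by (intro exI[of _ 1]) auto
next
  case (insert a I)
  then obtain N where N: "N > 0" "\<forall>i\<in>I. \<exists>k. of_int N * q i = of_int k" by blast
  obtain m n where mn: "q a = of_int m / of_int n" "n > 0"
    by (metis Rat_cases Fract_of_int_quotient)
  show ?case
  proof (rule exI[of _ "N * n"], intro conjI ballI)
    show "N * n > 0" using N mn by simp
    fix i assume "i \<in> insert a I"
    then consider "i = a" | k where "of_int N * q i = of_int k" using N by blast
    then show "\<exists>k. of_int (N * n) * q i = of_int k"
    proof cases
      case 1
      have "of_int (N * n) * q i = of_int (N * m)" unfolding 1 mn(1) using mn(2) by simp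
      then show ?thesis by blast
    next
      case (2 k)
      have "of_int (N * n) * q i = of_int n * (of_int N * q i)" by simp
      also have "\<dots> = of_int (n * k)" unfolding 2 by simp
      finally have "of_int (N * n) * q i = of_int (n * k)" .
      then show ?thesis by blast
    qed
  qed
qed

lemma int_independent_imp_rat_independent:
  assumes "finite B" "int_mod.independent B"
  shows "rat_vs.independent B"
proof
  assume "rat_vs.dependent B"
  then obtain q where q: "\<exists>b\<in>B. q b \<noteq> 0" "(\<Sum>b\<in>B. of_rat (q b) * b) = 0"
    using rat_vs.dependent_finite assms(1) by blast
  obtain N k where N: "N > 0" "\<And>b. b \<in> B \<Longrightarrow> of_int N * q b = of_int (k b)"
    using common_denominator[OF assms(1), of q] by metis
  have eq: "of_int (k b) = of_int N * (of_rat (q b) :: 'a)" if "b \<in> B" for b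
    using N(2)[OF that] by (metis of_rat_mult of_rat_of_int_eq)
  have "(\<Sum>b\<in>B. of_int (k b) * b) = of_int N * (\<Sum>b\<in>B. of_rat (q b) * b)"
    unfolding sum_distrib_left by (intro sum.cong refl) (simp add: eq mult.assoc)
  then have "(\<Sum>b\<in>B. of_int (k b) * b) = 0" using q by simp
  then have "\<forall>b\<in>B. k b = 0"
    using int_mod.dependent_finite[OF assms(1)] assms(2) by blast
  then show False using q(1) N by (metis mult_eq_0_iff of_int_0 of_int_0_eq_iff less_irrefl)
qed

lemma int_span_list:
  fixes gs :: "'a::field_char_0 list"
  assumes "distinct gs" "x \<in> int_mod.span (set gs)"
  obtains c where "x = (\<Sum>j<length gs. of_int (c j) * gs ! j)"
proof -
  have "x \<in> range (\<lambda>u. \<Sum>v\<in>set gs. of_int (u v) * v)"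
    using assms(2) by (simp add: int_mod.span_finite)
  then obtain u where "x = (\<Sum>v\<in>set gs. of_int (u v) * v)" by blast
  also have "\<dots> = (\<Sum>j<length gs. of_int (u (gs ! j)) * gs ! j)"
    using bij_betw_nth[OF assms(1) refl refl] by (rule sum.reindex_bij_betw[symmetric])
  finally show ?thesis by (rule that[of "\<lambda>j. u (gs ! j)"])
qed

text \<open>The determinant trick: \<open>x\<close> is an eigenvalue of the integer matrix of multiplication by \<open>x\<close>
  on the generators.\<close>

lemma algebraic_int_if_stable:
  fixes x :: "'a::field_char_0"
  assumes G: "finite G" and g: "g \<in> G" "g \<noteq> 0" and stable: "\<And>h. h \<in> G \<Longrightarrow> x * h \<in> int_mod.span G"
  shows "algebraic_int x"
proof -
  obtain gs where gs: "set gs = G" "distinct gs" using finite_distinct_list[OF G] by blast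
  define n where "n = length gs"
  have "\<exists>c. x * gs ! i = (\<Sum>j<n. of_int (c j) * gs ! j)" if "i < n" for i
    using int_span_list[OF gs(2)] stable[of "gs ! i"] that gs(1) unfolding n_def by (metis nth_mem)
  then obtain c where c: "\<And>i. i < n \<Longrightarrow> x * gs ! i = (\<Sum>j<n. of_int (c i j) * gs ! j)" by metis
  define P where "P = mat n n (\<lambda>(i, j). c i j)"
  define Q where "Q = (of_int_hom.mat_hom P :: 'a mat)"
  define v where "v = vec n (\<lambda>i. gs ! i)"
  have dims: "P \<in> carrier_mat n n" "Q \<in> carrier_mat n n" "v \<in> carrier_vec n"
    unfolding P_def Q_def v_def by auto
  have "Q *\<^sub>v v = x \<cdot>\<^sub>v v"
    by (rule eq_vecI) (auto simp: Q_def P_def v_def scalar_prod_def c atLeast0LessThan)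
  moreover have "v \<noteq> 0\<^sub>v n"
  proof -
    obtain i where "i < n" "gs ! i = g" using g(1) gs(1) unfolding n_def by (metis in_set_conv_nth)
    then show ?thesis using g(2) unfolding v_def by (metis index_vec index_zero_vec(1))
  qed
  ultimately have "eigenvalue Q x"
    using dims unfolding eigenvalue_def eigenvector_def by auto
  then have "poly (char_poly Q) x = 0" using eigenvalue_root_char_poly[OF dims(2)] by simp
  moreover have "char_poly Q = map_poly of_int (char_poly P)"
    unfolding Q_def by (rule of_int_hom.char_poly_hom[OF dims(1)])
  moreover have "lead_coeff (char_poly P) = 1" using degree_monic_char_poly[OF dims(1)] by simp
  ultimately show ?thesis unfolding algebraic_int_altdef_ipoly by metis
qed

section \<open>Finitely generated subrings and integral elements\<close>

text \<open>Additive closure is carried by R being an integer span. No full rank is asked for, so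
  adjoining elements one at a time can start from the ring of rational integers.\<close>

definition finite_subring :: "'a::field_char_0 set \<Rightarrow> bool" where
  "finite_subring R \<longleftrightarrow> 1 \<in> R \<and> (\<forall>x\<in>R. \<forall>y\<in>R. x * y \<in> R) \<and> (\<exists>G. finite G \<and> int_mod.span G = R)"

lemma finite_subringD:
  assumes "finite_subring R"
  shows "1 \<in> R" "x \<in> R \<Longrightarrow> y \<in> R \<Longrightarrow> x * y \<in> R" "int_mod.subspace R"
    and "\<exists>G. finite G \<and> int_mod.span G = R"
  using assms unfolding finite_subring_def by auto

lemma finite_subring_algebraic_int:
  assumes R: "finite_subring R" and x: "x \<in> R"
  shows "algebraic_int x"
proof -
  obtain G where G: "finite G" "int_mod.span G = R" using R unfolding finite_subring_def by blast
  have "\<exists>g\<in>G. g \<noteq> 0"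
  proof (rule ccontr)
    assume "\<not> ?thesis"
    then have "G \<subseteq> {0}" by auto
    then have "int_mod.span G \<subseteq> int_mod.span {0}" by (rule int_mod.span_mono)
    moreover have "int_mod.span {0 :: 'a} = {0}" unfolding int_mod.span_singleton by auto
    ultimately have "R \<subseteq> {0}" unfolding G(2) by simp
    then show False using finite_subringD(1)[OF R] by (metis singletonD subsetD zero_neq_one)
  qed
  then obtain g where g: "g \<in> G" "g \<noteq> 0" by blast
  show ?thesis
  proof (rule algebraic_int_if_stable[OF G(1) g])
    fix h assume "h \<in> G"
    then have "h \<in> R" using G(2) int_mod.span_base by blast
    then show "x * h \<in> int_mod.span G" using G(2) finite_subringD(2)[OF R x] by simp
  qed
qed

text \<open>S is R[x], spanned by the products of generators of R with powers of x below the degree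
  k of a monic equation. The equation brings x^k back into the span; closure under x and under R
  separately then gives closure under products.\<close>

lemma finite_subring_adjoin:
  assumes R: "finite_subring R" and x: "algebraic_int x"
    and M: "number_field M" "R \<subseteq> M" "x \<in> M"
  obtains S where "finite_subring S" "R \<subseteq> S" "x \<in> S" "S \<subseteq> M"
proof -
  obtain G where G: "finite G" "int_mod.span G = R" using R unfolding finite_subring_def by blast
  then have GR: "G \<subseteq> R" using int_mod.span_superset by blast
  obtain p :: "int poly" where p: "poly (map_poly of_int p) x = 0" "lead_coeff p = 1"
    using x unfolding algebraic_int_altdef_ipoly by metis
  define k a where "k = degree p" and "a = coeff p"
  have xk: "x ^ k = - (\<Sum>i<k. of_int (a i) * x ^ i)"
  proof -
    have "(\<Sum>i\<le>k. of_int (a i) * x ^ i) = 0"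
      using p(1) unfolding poly_altdef k_def a_def by simp
    then have "(\<Sum>i<k. of_int (a i) * x ^ i) + x ^ k = 0"
      using p(2) unfolding k_def a_def by (simp add: lessThan_Suc_atMost[symmetric])
    then show ?thesis by (simp add: eq_neg_iff_add_eq_0 add.commute)
  qed
  have k0: "k > 0"
  proof (rule ccontr)
    assume "\<not> k > 0" then show False using xk by simp
  qed
  define T where "T = (\<lambda>(g, j). g * x ^ j) ` (G \<times> {..<k})"
  define S where "S = int_mod.span T"
  have sub: "int_mod.subspace S" unfolding S_def by (rule int_mod.subspace_span)
  have low: "r * x ^ j \<in> S" if "r \<in> R" "j < k" for r j
  proof -
    have "r \<in> int_mod.span G" using that(1) G(2) by simp
    then show ?thesis
    proof (induction rule: int_mod.span_induct_alt)
      case base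
      then show ?case using int_mod.subspace_0[OF sub] by simp
    next
      case (step c g y)
      have "g * x ^ j \<in> S" unfolding S_def T_def using step(1) that(2) by (intro int_mod.span_base) auto
      then have "of_int c * (g * x ^ j) + y * x ^ j \<in> S"
        using step(2) sub by (intro int_mod.subspace_add int_mod.subspace_scale)
      then show ?case by (simp add: algebra_simps)
    qed
  qed
  have top: "r * x ^ k \<in> S" if "r \<in> R" for r
  proof -
    have "(\<Sum>i<k. of_int (- a i) * (r * x ^ i)) \<in> S"
      using low[OF that] sub by (intro int_mod.subspace_sum int_mod.subspace_scale) auto
    also have "(\<Sum>i<k. of_int (- a i) * (r * x ^ i)) = r * x ^ k"
      unfolding xk by (simp add: sum_negf sum_distrib_left mult_ac)
    finally show ?thesis .
  qed
  have mult_x: "s * x \<in> S" if "s \<in> S" for s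
    using that[unfolded S_def]
  proof (induction rule: int_mod.span_induct_alt)
    case base
    then show ?case using int_mod.subspace_0[OF sub] by simp
  next
    case (step c t y)
    then obtain g j where t: "g \<in> G" "j < k" "t = g * x ^ j" unfolding T_def by auto
    have "g * x ^ Suc j \<in> S" using low[of g "Suc j"] top[of g] t GR by (cases "Suc j = k") auto
    then have "of_int c * (g * x ^ Suc j) + y * x \<in> S"
      using step(2) sub by (intro int_mod.subspace_add int_mod.subspace_scale)
    then show ?case using t(3) by (simp add: algebra_simps)
  qed
  have mult_R: "s * r \<in> S" if "s \<in> S" "r \<in> R" for s r
    using that(1)[unfolded S_def]
  proof (induction rule: int_mod.span_induct_alt)
    case base
    then show ?case using int_mod.subspace_0[OF sub] by simp
  next
    case (step c t y)
    then obtain g j where t: "g \<in> G" "j < k" "t = g * x ^ j" unfolding T_def by auto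
    have "(g * r) * x ^ j \<in> S" using low t(1,2) GR that(2) finite_subringD(2)[OF R] by blast
    then have "of_int c * ((g * r) * x ^ j) + y * r \<in> S"
      using step(2) sub by (intro int_mod.subspace_add int_mod.subspace_scale)
    then show ?case using t(3) by (simp add: algebra_simps)
  qed
  have mult: "s * t \<in> S" if "s \<in> S" "t \<in> S" for s t
    using that(2)[unfolded S_def]
  proof (induction rule: int_mod.span_induct_alt)
    case base
    then show ?case using int_mod.subspace_0[OF sub] by simp
  next
    case (step c t y)
    then obtain g j where t: "g \<in> G" "t = g * x ^ j" unfolding T_def by auto
    have "s * g * x ^ i \<in> S" for i
    proof (induction i)
      case 0
      show ?case using mult_R[OF that(1)] t(1) GR by auto
    next
      case (Suc i)
      then show ?case using mult_x[of "s * g * x ^ i"] by (simp add: mult_ac)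
    qed
    then have "of_int c * (s * g * x ^ j) + s * y \<in> S"
      using step(2) sub by (intro int_mod.subspace_add int_mod.subspace_scale)
    then show ?case using t(2) by (simp add: algebra_simps)
  qed
  have RS: "R \<subseteq> S" using low[of _ 0] k0 by auto
  then have one: "1 \<in> S" using finite_subringD(1)[OF R] by blast
  have "x \<in> S" using mult_x[OF one] by simp
  have "finite T" unfolding T_def using G(1) by simp
  then have "finite_subring S" unfolding finite_subring_def using one mult S_def by blast
  have pow: "x ^ j \<in> M" for j
    using number_field_one[OF M(1)] number_field_mult[OF M(1,3)] by (induction j) auto
  have "T \<subseteq> M" unfolding T_def using GR M(2) pow number_field_mult[OF M(1)] by auto
  then have "S \<subseteq> M"
    unfolding S_def using number_field_int_subspace[OF M(1)] by (rule int_mod.span_minimal)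
  show ?thesis by (rule that) fact+
qed

text \<open>The denominators cleared are those of the matrix of multiplication by x on a rational
  basis. Then N x maps the lattice spanned by that basis into itself, and the determinant trick
  applies.\<close>

lemma integral_multiple:
  assumes M: "number_field M" and x: "x \<in> M"
  obtains N :: int where "N > 0" "of_int N * x \<in> ring_of_integers M"
proof -
  obtain B where B: "rat_basis M B" using rat_basis_exists[OF M] .
  note Bs = rat_basisD[OF B]
  let ?r = "rat_vs.representation B"
  obtain N where N: "N > 0" "\<forall>i\<in>B \<times> B. \<exists>k. of_int N * (\<lambda>(b, c). ?r (x * b) c) i = of_int k"
    using common_denominator[of "B \<times> B"] Bs(1) by (metis finite_cartesian_product)
  have "of_int N * x * b \<in> int_mod.span B" if b: "b \<in> B" for b
  proof -
    have "x * b \<in> M" using M x b Bs(4) number_field_mult by blast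
    then have "x * b = (\<Sum>c\<in>B. of_rat (?r (x * b) c) * c)"
      using rat_vs.sum_representation_eq[OF Bs(2) _ Bs(1) subset_refl] Bs(3) by simp
    then have "of_int N * x * b = of_int N * (\<Sum>c\<in>B. of_rat (?r (x * b) c) * c)"
      by (simp add: mult.assoc)
    also have "\<dots> = (\<Sum>c\<in>B. of_rat (of_int N * ?r (x * b) c) * c)"
      by (simp add: mult.assoc sum_distrib_left of_rat_mult)
    also have "\<dots> \<in> int_mod.span B"
    proof (rule int_mod.span_sum)
      fix c assume c: "c \<in> B"
      then obtain k where "of_int N * ?r (x * b) c = of_int k" using N(2) b by fastforce
      then show "of_rat (of_int N * ?r (x * b) c) * c \<in> int_mod.span B"
        using int_mod.span_scale[OF int_mod.span_base[OF c], of k] by simp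
    qed
    finally show ?thesis .
  qed
  moreover obtain b where "b \<in> B" "b \<noteq> 0"
  proof -
    have "B \<noteq> {}" using Bs number_field_one[OF M] by auto
    moreover have "0 \<notin> B" using Bs(2) rat_vs.dependent_zero by blast
    ultimately show ?thesis using that by blast
  qed
  ultimately have "algebraic_int (of_int N * x)"
    using algebraic_int_if_stable[OF Bs(1)] by blast
  moreover have "of_int N * x \<in> M" using number_field_scale[OF M x, of "of_int N"] by simp
  ultimately show ?thesis using that[OF N(1)] unfolding ring_of_integers_def by blast
qed

section \<open>The ring of integers\<close>

lemma number_field_lincomb:
  assumes M: "number_field M" and "\<And>i. i \<in> I \<Longrightarrow> f i \<in> M"
  shows "(\<Sum>i\<in>I. of_rat (q i) * f i) \<in> M"
    and field_trace_lincomb: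
      "field_trace M (\<Sum>i\<in>I. of_rat (q i) * f i) = (\<Sum>i\<in>I. q i * field_trace M (f i))"
proof -
  have *: "of_rat (q i) * f i \<in> M" if "i \<in> I" for i
    using number_field_scale[OF M assms(2)[OF that]] .
  then show "(\<Sum>i\<in>I. of_rat (q i) * f i) \<in> M"
    by (rule rat_vs.subspace_sum[OF number_field_subspace[OF M]])
  have "field_trace M (\<Sum>i\<in>I. of_rat (q i) * f i) = (\<Sum>i\<in>I. field_trace M (of_rat (q i) * f i))"
    using * by (rule field_trace_sum[OF M])
  also have "\<dots> = (\<Sum>i\<in>I. q i * field_trace M (f i))"
    using assms(2) by (intro sum.cong refl field_trace_scale[OF M])
  finally show "field_trace M (\<Sum>i\<in>I. of_rat (q i) * f i) = (\<Sum>i\<in>I. q i * field_trace M (f i))" .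
qed

lemma trace_matrix_change_basis:
  assumes M: "number_field M" and bs: "set bs \<subseteq> M"
    and P: "P \<in> carrier_mat (length cs) (length bs)"
    and cs: "\<And>i. i < length cs \<Longrightarrow> cs ! i = (\<Sum>j<length bs. of_rat (P $$ (i, j)) * bs ! j)"
  shows "trace_matrix M cs = P * trace_matrix M bs * transpose_mat P"
proof (rule eq_matI)
  let ?n = "length cs" and ?m = "length bs" and ?t = "field_trace M"
  fix i k assume "i < dim_row (P * trace_matrix M bs * transpose_mat P)"
    "k < dim_col (P * trace_matrix M bs * transpose_mat P)"
  then have ik: "i < ?n" "k < ?n" using P by auto
  have bM: "bs ! j \<in> M" if "j < ?m" for j using bs that by auto
  have "cs ! i * cs ! k =
      (\<Sum>j<?m. \<Sum>l<?m. of_rat (P $$ (i, j) * P $$ (k, l)) * (bs ! j * bs ! l))"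
    unfolding cs[OF ik(1)] cs[OF ik(2)] sum_product by (simp add: of_rat_mult mult_ac)
  also have "?t \<dots> = (\<Sum>j<?m. \<Sum>l<?m. P $$ (i, j) * P $$ (k, l) * ?t (bs ! j * bs ! l))"
    using bM number_field_mult[OF M]
    by (subst field_trace_sum[OF M])
      (auto intro!: sum.cong number_field_lincomb[OF M] field_trace_lincomb[OF M])
  also have "\<dots> = (\<Sum>l<?m. (\<Sum>j<?m. P $$ (i, j) * ?t (bs ! j * bs ! l)) * P $$ (k, l))"
    unfolding sum_distrib_right by (subst sum.swap) (simp add: mult_ac)
  also have "\<dots> = (P * trace_matrix M bs * transpose_mat P) $$ (i, k)"
    using P ik by (simp add: trace_matrix_def scalar_prod_def atLeast0LessThan)
  finally show "trace_matrix M cs $$ (i, k) = (P * trace_matrix M bs * transpose_mat P) $$ (i, k)"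
    using ik by (simp add: trace_matrix_def)
qed (use P in \<open>auto simp: trace_matrix_def\<close>)

lemma det_trace_matrix_change_basis:
  assumes "number_field M" "set bs \<subseteq> M" "length cs = length bs"
    and P: "P \<in> carrier_mat (length bs) (length bs)"
    and "\<And>i. i < length bs \<Longrightarrow> cs ! i = (\<Sum>j<length bs. of_int (P $$ (i, j)) * bs ! j)"
  shows "det (trace_matrix M cs) = of_int ((det P)^2) * det (trace_matrix M bs)"
proof -
  let ?P = "of_int_hom.mat_hom P :: rat mat"
  have cP: "?P \<in> carrier_mat (length bs) (length bs)" using P by simp
  have "trace_matrix M cs = ?P * trace_matrix M bs * transpose_mat ?P"
    using assms P by (intro trace_matrix_change_basis) auto
  also have "det \<dots> = det ?P * det (trace_matrix M bs) * det ?P"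
    using cP by (simp add: det_mult[of _ "length bs"] det_transpose trace_matrix_def)
  finally show ?thesis by (simp add: power2_eq_square)
qed

lemma rat_span_list:
  assumes "distinct bs" "x \<in> rat_vs.span (set bs)"
  obtains c where "x = (\<Sum>j<length bs. of_rat (c j) * bs ! j)"
proof -
  have "x \<in> range (\<lambda>u. \<Sum>v\<in>set bs. of_rat (u v) * v)"
    using assms(2) by (simp add: rat_vs.span_finite)
  then obtain u where "x = (\<Sum>v\<in>set bs. of_rat (u v) * v)" by blast
  also have "\<dots> = (\<Sum>j<length bs. of_rat (u (bs ! j)) * bs ! j)"
    using bij_betw_nth[OF assms(1) refl refl] by (rule sum.reindex_bij_betw[symmetric])
  finally show ?thesis by (rule that[of "\<lambda>j. u (bs ! j)"])
qed

lemma rat_independent_list: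
  assumes "distinct bs" "rat_vs.independent (set bs)"
    and "(\<Sum>j<length bs. of_rat (c j) * bs ! j) = 0" and "i < length bs"
  shows "c i = 0"
proof -
  define u where "u b = c (inv_into {..<length bs} ((!) bs) b)" for b
  have bij: "bij_betw ((!) bs) {..<length bs} (set bs)" using bij_betw_nth[OF assms(1) refl refl] .
  then have u: "u (bs ! j) = c j" if "j < length bs" for j
    unfolding u_def using that by (simp add: bij_betw_inv_into_left)
  have "(\<Sum>b\<in>set bs. of_rat (u b) * b) = (\<Sum>j<length bs. of_rat (u (bs ! j)) * bs ! j)"
    using bij by (rule sum.reindex_bij_betw[symmetric])
  also have "\<dots> = 0" using assms(3) u by simp
  finally have "\<forall>b\<in>set bs. u b = 0" using assms(2) rat_vs.dependent_finite[of "set bs"] by auto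
  then show ?thesis using u[OF assms(4)] assms(4) by auto
qed

text \<open>A kernel vector would give y \<noteq> 0 with all traces of \<open>b * y\<close> zero.
  Since \<open>inverse y\<close> is a combination of the basis, the trace of 1 would be zero, but it
  equals the degree.\<close>

lemma det_trace_matrix_nonzero:
  assumes M: "number_field M" and bs: "distinct bs" "rat_basis M (set bs)"
  shows "det (trace_matrix M bs) \<noteq> 0"
proof
  let ?n = "length bs" and ?T = "trace_matrix M bs"
  note Bs = rat_basisD[OF bs(2)]
  have bM: "bs ! j \<in> M" if "j < ?n" for j using Bs(4) that by auto
  assume "det ?T = 0"
  moreover have "?T \<in> carrier_mat ?n ?n" unfolding trace_matrix_def by simp
  ultimately obtain v where v: "v \<in> carrier_vec ?n" "v \<noteq> 0\<^sub>v ?n" "?T *\<^sub>v v = 0\<^sub>v ?n"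
    using det_0_iff_vec_prod_zero_field by blast
  define y where "y = (\<Sum>j<?n. of_rat (v $ j) * bs ! j)"
  have yM: "y \<in> M" unfolding y_def
    using bM number_field_scale[OF M] by (intro rat_vs.subspace_sum[OF number_field_subspace[OF M]]) auto
  have "y \<noteq> 0"
  proof
    assume "y = 0"
    then have "v $ i = 0" if "i < ?n" for i
      using rat_independent_list[OF bs(1) Bs(2), of "\<lambda>j. v $ j"] that unfolding y_def by blast
    then have "v = 0\<^sub>v ?n" using v(1) by (intro eq_vecI) auto
    then show False using v(2) by blast
  qed
  have tr0: "field_trace M (bs ! i * y) = 0" if i: "i < ?n" for i
  proof -
    have "bs ! i * y = (\<Sum>j<?n. of_rat (v $ j) * (bs ! i * bs ! j))"
      unfolding y_def sum_distrib_left by (simp add: mult_ac)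
    also have "field_trace M \<dots> = (\<Sum>j<?n. v $ j * field_trace M (bs ! i * bs ! j))"
      using bM i by (intro field_trace_lincomb[OF M] number_field_mult[OF M]) auto
    also have "\<dots> = (?T *\<^sub>v v) $ i"
      using i v(1) by (simp add: trace_matrix_def scalar_prod_def atLeast0LessThan mult.commute)
    finally show ?thesis using v(3) i by simp
  qed
  have "inverse y \<in> rat_vs.span (set bs)" using number_field_inverse[OF M yM] Bs(3) by simp
  then obtain c where c: "inverse y = (\<Sum>j<?n. of_rat (c j) * bs ! j)"
    using rat_span_list[OF bs(1)] by blast
  have "1 = inverse y * y" using \<open>y \<noteq> 0\<close> by simp
  also have "\<dots> = (\<Sum>j<?n. of_rat (c j) * (bs ! j * y))"
    unfolding c sum_distrib_right by (simp add: mult.assoc)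
  finally have "field_trace M 1 = field_trace M (\<Sum>j<?n. of_rat (c j) * (bs ! j * y))" by simp
  also have "\<dots> = (\<Sum>j<?n. c j * field_trace M (bs ! j * y))"
    using bM yM by (intro field_trace_lincomb[OF M] number_field_mult[OF M]) auto
  also have "\<dots> = 0" using tr0 by simp
  finally show False using field_trace_one[OF M] field_degree_pos[OF M] by simp
qed

lemma int_span_subset_rat_span: "int_mod.span B \<subseteq> rat_vs.span B"
proof (rule int_mod.span_minimal[OF rat_vs.span_superset])
  show "int_mod.subspace (rat_vs.span B)"
    unfolding int_mod.subspace_def
    using rat_vs.span_zero rat_vs.span_add rat_vs.span_scale[of _ B "of_int _"] by auto
qed

lemma finite_subring_basis:
  assumes R: "finite_subring R" and span: "rat_vs.span R = M"
  obtains bs where "distinct bs" "int_mod.independent (set bs)" "int_mod.span (set bs) = R"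
    "rat_basis M (set bs)"
proof -
  obtain G where G: "finite G" "int_mod.span G = R" using R unfolding finite_subring_def by blast
  obtain B where B: "finite B" "int_mod.independent B" "int_mod.span B = int_mod.span G"
    using int_span_basis[OF G(1)] .
  obtain bs where bs: "set bs = B" "distinct bs" using finite_distinct_list[OF B(1)] by blast
  have "rat_vs.span R \<subseteq> rat_vs.span B"
    using int_span_subset_rat_span[of B] B(3) G(2) by (intro rat_vs.span_minimal) auto
  moreover have "rat_vs.span B \<subseteq> rat_vs.span R"
    using B(3) G(2) int_mod.span_superset by (intro rat_vs.span_mono) auto
  ultimately have "rat_basis M B"
    unfolding rat_basis_def using B span int_independent_imp_rat_independent by auto
  then show ?thesis using that bs B G(2) by auto
qed

text \<open>An integer basis of R is also a rational basis of M, and in it multiplication by x has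
  an integer matrix.\<close>

lemma finite_subring_trace_int:
  assumes M: "number_field M" and R: "finite_subring R" "rat_vs.span R = M" and x: "x \<in> R"
  shows "field_trace M x \<in> \<int>"
proof -
  obtain bs where bs: "distinct bs" "int_mod.span (set bs) = R" "rat_basis M (set bs)"
    using finite_subring_basis[OF R] by metis
  note Bs = rat_basisD[OF bs(3)]
  have "rat_vs.representation (set bs) (x * b) b \<in> \<int>" if b: "b \<in> set bs" for b
  proof -
    have "x * b \<in> int_mod.span (set bs)"
      using b bs(2) finite_subringD(2)[OF R(1) x] int_mod.span_base by blast
    then obtain u where u: "x * b = (\<Sum>v\<in>set bs. of_int (u v) * v)"
      by (auto simp: int_mod.span_finite)
    define q where "q v = (if v \<in> set bs then of_int (u v) else 0 :: rat)" for v
    have "rat_vs.representation (set bs) (x * b) = q"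
    proof (rule rat_vs.representation_eqI[OF Bs(2)])
      show "x * b \<in> rat_vs.span (set bs)"
        using Bs(3,4) b x R(2) rat_vs.span_superset number_field_mult[OF M] by blast
      show "(\<Sum>v | q v \<noteq> 0. of_rat (q v) * v) = x * b"
        unfolding u by (rule sum.mono_neutral_cong_left) (auto simp: q_def)
      show "finite {v. q v \<noteq> 0}" by (rule finite_subset[of _ "set bs"]) (auto simp: q_def)
      show "v \<in> set bs" if "q v \<noteq> 0" for v using that unfolding q_def by (auto split: if_splits)
    qed
    then show ?thesis using b unfolding q_def by simp
  qed
  moreover have "x \<in> M" using x R(2) rat_vs.span_superset by blast
  ultimately show ?thesis by (auto simp: field_trace_eq[OF M bs(3)])
qed

lemma det_in_Ints:
  assumes "A \<in> carrier_mat n n" "\<And>i j. i < n \<Longrightarrow> j < n \<Longrightarrow> A $$ (i, j) \<in> \<int>"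
  shows "det A \<in> (\<int> :: rat set)"
proof -
  obtain f where f: "\<And>i j. i < n \<Longrightarrow> j < n \<Longrightarrow> A $$ (i, j) = of_int (f i j)"
  proof -
    show thesis if "\<And>f. (\<And>i j. i < n \<Longrightarrow> j < n \<Longrightarrow> A $$ (i, j) = of_int (f i j)) \<Longrightarrow> thesis" for thesis
    proof (rule that[of "\<lambda>i j. \<lfloor>A $$ (i, j)\<rfloor>"])
      fix i j assume "i < n" "j < n"
      from assms(2)[OF this] show "A $$ (i, j) = of_int \<lfloor>A $$ (i, j)\<rfloor>" by (auto elim!: Ints_cases)
    qed
  qed
  have "A = of_int_hom.mat_hom (mat n n (\<lambda>(i, j). f i j))"
    by (rule eq_matI) (use assms(1) f in auto)
  then have "det A = of_int (det (mat n n (\<lambda>(i, j). f i j)))" by simp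
  then show ?thesis by simp
qed

text \<open>Among the finitely generated subrings that span \<open>M\<close>, one whose discriminant is minimal in
  absolute value absorbs every integral element, since an extension of index \<open>n\<close> divides the
  discriminant by \<open>n\<^sup>2\<close>.\<close>

theorem ring_of_integers_finite_subring:
  assumes M: "number_field M"
  shows "finite_subring (ring_of_integers M)" and "rat_vs.span (ring_of_integers M) = M"
proof -
  obtain B where B: "rat_basis M B" using rat_basis_exists[OF M] .
  note Bs = rat_basisD[OF B]
  have "\<exists>N::int. N > 0 \<and> of_int N * b \<in> ring_of_integers M" if "b \<in> B" for b
    using integral_multiple[OF M] Bs(4) that by blast
  then obtain N :: "'a \<Rightarrow> int" where N: "\<And>b. b \<in> B \<Longrightarrow> N b > 0 \<and> of_int (N b) * b \<in> ring_of_integers M"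
    by metis
  \<comment> \<open>X consists of integral multiples of a basis, so every subring between X and M
    spans M and has a nonzero discriminant.\<close>
  define X where "X = (\<lambda>b. of_int (N b) * b) ` B"
  have X: "finite X" "X \<subseteq> ring_of_integers M" unfolding X_def using Bs(1) N by auto
  have "B \<subseteq> rat_vs.span X"
  proof
    fix b assume b: "b \<in> B"
    have "of_rat (1 / of_int (N b)) * (of_int (N b) * b) \<in> rat_vs.span X"
      unfolding X_def using b by (intro rat_vs.span_scale rat_vs.span_base) auto
    then show "b \<in> rat_vs.span X" using N[OF b] by (simp add: of_rat_divide)
  qed
  then have "M \<subseteq> rat_vs.span X" using Bs(3) rat_vs.span_minimal rat_vs.subspace_span by metis
  then have spanX: "rat_vs.span Y = M" if "X \<subseteq> Y" "Y \<subseteq> M" for Y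
    using that rat_vs.span_mono[OF that(1)] rat_vs.span_minimal[OF that(2) number_field_subspace[OF M]]
    by blast
  have "\<exists>R. finite_subring R \<and> Y \<subseteq> R \<and> R \<subseteq> M" if "finite Y" "Y \<subseteq> ring_of_integers M" for Y
    using that
  proof (induction Y)
    case empty
    have "finite_subring (int_mod.span {1 :: 'a})"
      unfolding finite_subring_def
    proof (intro conjI)
      show "\<exists>G. finite G \<and> int_mod.span G = int_mod.span {1 :: 'a}" by (rule exI[of _ "{1}"]) simp
    qed (auto simp: int_mod.span_singleton simp flip: of_int_mult intro: int_mod.span_base)
    moreover have "int_mod.span {1 :: 'a} \<subseteq> M"
      using number_field_one[OF M] number_field_int_subspace[OF M] by (intro int_mod.span_minimal) auto
    ultimately show ?case by blast
  next
    case (insert x Y)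
    then obtain R where R: "finite_subring R" "Y \<subseteq> R" "R \<subseteq> M" by blast
    have "algebraic_int x" "x \<in> M" using insert.prems unfolding ring_of_integers_def by auto
    from finite_subring_adjoin[OF R(1) this(1) M R(3) this(2)] R(2) show ?case
      by (metis insert_subset order_trans)
  qed
  then obtain R0 where R0: "finite_subring R0" "X \<subseteq> R0" "R0 \<subseteq> M" using X by blast
  let ?basis = "\<lambda>bs R. finite_subring R \<and> X \<subseteq> R \<and> R \<subseteq> M \<and> distinct bs \<and> int_mod.span (set bs) = R
    \<and> rat_basis M (set bs)"
  let ?disc = "\<lambda>bs d. of_int d = det (trace_matrix M bs)"
  have basis: "\<exists>bs d. ?basis bs R \<and> ?disc bs d" if R: "finite_subring R" "X \<subseteq> R" "R \<subseteq> M" for R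
  proof -
    obtain bs where bs: "distinct bs" "int_mod.span (set bs) = R" "rat_basis M (set bs)"
      using finite_subring_basis[OF R(1) spanX[OF R(2,3)]] by metis
    have "bs ! i \<in> R" if "i < length bs" for i using that bs(2) int_mod.span_superset by fastforce
    then have "det (trace_matrix M bs) \<in> \<int>"
      unfolding trace_matrix_def
      using finite_subring_trace_int[OF M R(1) spanX[OF R(2,3)]] finite_subringD(2)[OF R(1)]
      by (intro det_in_Ints[of _ "length bs"]) auto
    then show ?thesis using bs R by (metis Ints_cases)
  qed
  let ?Q = "\<lambda>m. \<exists>bs R d. ?basis bs R \<and> ?disc bs d \<and> m = nat \<bar>d\<bar>"
  have "\<exists>m. ?Q m" using basis[OF R0] by blast
  then obtain m where "?Q m" and least: "\<And>k. ?Q k \<Longrightarrow> m \<le> k"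
    using LeastI_ex[of ?Q] Least_le[of ?Q] by blast
  then obtain bs R d where bs: "?basis bs R" "?disc bs d" "m = nat \<bar>d\<bar>" by blast
  have "ring_of_integers M \<subseteq> R"
  proof
    fix x assume "x \<in> ring_of_integers M"
    then have "algebraic_int x" "x \<in> M" unfolding ring_of_integers_def by auto
    then obtain S where S: "finite_subring S" "R \<subseteq> S" "x \<in> S" "S \<subseteq> M"
      using finite_subring_adjoin[of R x M] M bs(1) by metis
    then obtain cs e where cs: "?basis cs S" "?disc cs e" using basis[of S] bs(1) by blast
    define n where "n = length bs"
    have n: "length cs = n"
      using card_rat_basis bs(1) cs(1) distinct_card unfolding n_def by metis
    have "\<exists>c. bs ! i = (\<Sum>j<n. of_int (c j) * cs ! j)" if "i < n" for i
    proof -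
      have "bs ! i \<in> int_mod.span (set cs)"
        using that S(2) bs(1) cs(1) int_mod.span_superset unfolding n_def by (metis nth_mem subsetD)
      then show ?thesis using int_span_list[of cs "bs ! i"] cs(1) n by metis
    qed
    then obtain c where c: "\<And>i. i < n \<Longrightarrow> bs ! i = (\<Sum>j<n. of_int (c i j) * cs ! j)" by metis
    define P where "P = mat n n (\<lambda>(i, j). c i j)"
    have P: "P \<in> carrier_mat n n" unfolding P_def by simp
    have "of_int d = of_int ((det P)^2) * (of_int e :: rat)"
      unfolding bs(2) cs(2)
      using P c n cs(1) rat_basisD(4)[of M "set cs"]
      by (intro det_trace_matrix_change_basis[OF M]) (auto simp: P_def n_def)
    then have de: "d = (det P)^2 * e" by (metis of_int_eq_iff of_int_mult)
    have "d \<noteq> 0" using det_trace_matrix_nonzero[OF M] bs(1,2) by (metis of_int_0)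
    moreover have "m \<le> nat \<bar>e\<bar>" using least cs by blast
    then have "\<bar>d\<bar> \<le> \<bar>e\<bar>" unfolding bs(3) by simp
    ultimately have "(det P)^2 = 1"
    proof -
      have "(det P)^2 * \<bar>e\<bar> \<le> 1 * \<bar>e\<bar>" using de \<open>\<bar>d\<bar> \<le> \<bar>e\<bar>\<close> by (simp add: abs_mult)
      then have "(det P)^2 \<le> 1" using \<open>d \<noteq> 0\<close> de by (simp only: mult_le_cancel_right) auto
      moreover have "(det P)^2 > 0" using \<open>d \<noteq> 0\<close> de by auto
      ultimately show ?thesis by linarith
    qed
    \<comment> \<open>Because the determinant of P squares to 1, \<open>det P\<close> times the
      adjugate is an integral inverse of P. It expresses the basis of S through that of R.\<close>
    define A :: "'a mat" where "A = of_int_hom.mat_hom (det P \<cdot>\<^sub>m adj_mat P)"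
    define v w where "v = vec n (\<lambda>i. bs ! i)" and "w = vec n (\<lambda>i. cs ! i)"
    have vw: "v = of_int_hom.mat_hom P *\<^sub>v w"
      by (rule eq_vecI) (auto simp: P_def v_def w_def scalar_prod_def c atLeast0LessThan)
    have adj: "adj_mat P \<in> carrier_mat n n" "adj_mat P * P = det P \<cdot>\<^sub>m 1\<^sub>m n"
      using adj_mat[OF P] by auto
    have "(det P \<cdot>\<^sub>m adj_mat P) * P = det P \<cdot>\<^sub>m (det P \<cdot>\<^sub>m 1\<^sub>m n)"
      using adj P by (simp add: mult_smult_assoc_mat[of _ n n])
    also have "\<dots> = 1\<^sub>m n"
      using \<open>(det P)^2 = 1\<close> by (intro eq_matI) (auto simp: power2_eq_square)
    finally have "(det P \<cdot>\<^sub>m adj_mat P) * P = 1\<^sub>m n" .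
    then have "A * of_int_hom.mat_hom P = (1\<^sub>m n :: 'a mat)"
      unfolding A_def using adj(1) P
      by (metis of_int_hom.mat_hom_mult of_int_hom.mat_hom_one smult_carrier_mat)
    then have wv: "w = A *\<^sub>v v"
      unfolding vw using adj(1) P
      by (subst assoc_mult_mat_vec[symmetric, of _ n n _ n]) (auto simp: A_def w_def)
    have "cs ! i \<in> R" if i: "i < n" for i
    proof -
      have "cs ! i = w $ i" using i unfolding w_def by simp
      also have "\<dots> = (\<Sum>j<n. of_int (det P * adj_mat P $$ (i, j)) * bs ! j)"
        unfolding wv using adj(1) i
        by (auto simp: A_def v_def scalar_prod_def atLeast0LessThan intro!: sum.cong)
      also have "\<dots> \<in> int_mod.span (set bs)"
        unfolding n_def by (intro int_mod.span_sum int_mod.span_scale int_mod.span_base) auto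
      finally show ?thesis using bs(1) by blast
    qed
    then have "set cs \<subseteq> R" using n by (auto simp: in_set_conv_nth)
    then have "S \<subseteq> R" using cs(1) bs(1) int_mod.span_minimal int_mod.subspace_span by metis
    then show "x \<in> R" using S(3) by blast
  qed
  moreover have "R \<subseteq> ring_of_integers M"
    using finite_subring_algebraic_int bs(1) unfolding ring_of_integers_def by blast
  ultimately have "R = ring_of_integers M" by blast
  then show "finite_subring (ring_of_integers M)" "rat_vs.span (ring_of_integers M) = M"
    using bs(1) spanX by blast+
qed

section \<open>Integral bases and the discriminant\<close>

lemma integral_basis_rat_basis:
  assumes M: "number_field M" and bs: "integral_basis M bs"
  shows "rat_basis M (set bs)"
proof -
  have bs': "int_mod.independent (set bs)" "int_mod.span (set bs) = ring_of_integers M"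
    using bs unfolding integral_basis_def by auto
  have "set bs \<subseteq> ring_of_integers M" using bs'(2) int_mod.span_superset by blast
  then have "rat_vs.span (set bs) \<subseteq> M"
    using rat_vs.span_mono ring_of_integers_finite_subring(2)[OF M] by metis
  moreover have "M \<subseteq> rat_vs.span (set bs)"
    using rat_vs.span_minimal[OF int_span_subset_rat_span[of "set bs"] rat_vs.subspace_span]
    unfolding bs'(2) ring_of_integers_finite_subring(2)[OF M] .
  ultimately show ?thesis
    using int_independent_imp_rat_independent[OF _ bs'(1)] unfolding rat_basis_def by auto
qed

lemma det_trace_matrix_sublattice:
  assumes M: "number_field M" and bs: "set bs \<subseteq> M" "distinct bs" and len: "length cs = length bs"
    and sub: "set cs \<subseteq> int_mod.span (set bs)"
  shows "\<exists>k::int. det (trace_matrix M cs) = of_int (k^2) * det (trace_matrix M bs)"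
proof -
  define n where "n = length bs"
  have "\<exists>c. cs ! i = (\<Sum>j<n. of_int (c j) * bs ! j)" if "i < n" for i
  proof -
    have "cs ! i \<in> int_mod.span (set bs)" using that sub len unfolding n_def by auto
    then show ?thesis using int_span_list[OF bs(2)] unfolding n_def by metis
  qed
  then obtain c where c: "\<And>i. i < n \<Longrightarrow> cs ! i = (\<Sum>j<n. of_int (c i j) * bs ! j)" by metis
  show ?thesis
    using c len bs(1) by (intro exI[of _ "det (mat n n (\<lambda>(i, j). c i j))"]
        det_trace_matrix_change_basis[OF M]) (auto simp: n_def)
qed

text \<open>Two integral bases lie in the span of each other, so their trace determinants differ by
  integer squares in both directions. The determinants are nonzero, hence the product of the two
  squares is 1 and the description in \<open>field_discr\<close> is proper.\<close>

lemma field_discr_eq: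
  assumes M: "number_field M" and bs: "integral_basis M bs"
  shows "of_int (field_discr M) = det (trace_matrix M bs)"
proof -
  note R = ring_of_integers_finite_subring[OF M]
  have span: "int_mod.span (set cs) = ring_of_integers M" "distinct cs" "set cs \<subseteq> M"
    if "integral_basis M cs" for cs
    using that rat_basisD(4)[OF integral_basis_rat_basis[OF M that]] unfolding integral_basis_def by auto
  have "bs ! i \<in> ring_of_integers M" if "i < length bs" for i
    using nth_mem[OF that] span(1)[OF bs] int_mod.span_base[of "bs ! i" "set bs"] by simp
  then have "det (trace_matrix M bs) \<in> \<int>"
    unfolding trace_matrix_def
    using finite_subring_trace_int[OF M R] finite_subringD(2)[OF R(1)]
    by (intro det_in_Ints[of _ "length bs"]) auto
  then obtain d :: int where d: "of_int d = det (trace_matrix M bs)" by (metis Ints_cases)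
  have uniq: "det (trace_matrix M cs) = det (trace_matrix M bs)" if cs: "integral_basis M cs" for cs
  proof -
    have len: "length cs = length bs"
      using card_rat_basis[OF integral_basis_rat_basis[OF M bs]]
        card_rat_basis[OF integral_basis_rat_basis[OF M cs]] span(2)[OF cs] span(2)[OF bs]
      by (simp add: distinct_card)
    have sub: "set cs \<subseteq> int_mod.span (set bs)" "set bs \<subseteq> int_mod.span (set cs)"
      using span(1)[OF cs] span(1)[OF bs] int_mod.span_superset by blast+
    obtain k where k: "det (trace_matrix M cs) = of_int (k^2) * det (trace_matrix M bs)"
      using det_trace_matrix_sublattice[OF M span(3,2)[OF bs] len sub(1)] by blast
    obtain l where l: "det (trace_matrix M bs) = of_int (l^2) * det (trace_matrix M cs)"
      using det_trace_matrix_sublattice[OF M span(3,2)[OF cs] len[symmetric] sub(2)] by blast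
    define X where "X = det (trace_matrix M bs)"
    have "X \<noteq> 0"
      unfolding X_def using det_trace_matrix_nonzero[OF M span(2)[OF bs] integral_basis_rat_basis[OF M bs]] .
    moreover have "X = of_int (l^2) * (of_int (k^2) * X)"
      unfolding X_def k[symmetric] by (rule l)
    then have "of_int (l^2 * k^2) * X = 1 * X" by (simp add: mult.assoc)
    ultimately have "of_int (l^2 * k^2) = (1 :: rat)" by (simp only: mult_cancel_right) simp
    then have "l^2 * k^2 = 1" by (simp only: of_int_eq_1_iff)
    then have "k^2 dvd 1" by (metis dvd_triv_right)
    then have "k^2 = 1" by simp
    then show ?thesis using k by simp
  qed
  have "field_discr M = d"
    unfolding field_discr_def
  proof (rule the_equality)
    show "\<exists>bs. integral_basis M bs \<and> of_int d = det (trace_matrix M bs)" using bs d by blast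
    fix e assume "\<exists>cs. integral_basis M cs \<and> of_int e = det (trace_matrix M cs)"
    then have "of_int e = (of_int d :: rat)" using uniq d by metis
    then show "e = d" by (simp only: of_int_eq_iff)
  qed
  then show ?thesis using d by simp
qed

text \<open>A set with fewer elements than the degree cannot span M over the rationals. Generators
  can therefore be exchanged by checking only span and cardinality.\<close>

lemma int_independent_if_card_le:
  assumes M: "number_field M" and G: "finite G" "int_mod.span G = ring_of_integers M"
    and card: "card G \<le> field_degree M"
  shows "int_mod.independent G" "card G = field_degree M"
proof -
  have span: "M \<subseteq> rat_vs.span G"
    using rat_vs.span_minimal[OF int_span_subset_rat_span[of G] rat_vs.subspace_span]
    unfolding G(2) ring_of_integers_finite_subring(2)[OF M] .
  have dim: "field_degree M \<le> card X" if "finite X" "M \<subseteq> rat_vs.span X" for X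
    unfolding field_degree_def using rat_vs.dim_le_card[OF that(2,1)] .
  show "card G = field_degree M" using dim[OF G(1) span] card by simp
  have "rat_vs.independent G"
  proof
    assume "rat_vs.dependent G"
    then obtain g where g: "g \<in> G" "g \<in> rat_vs.span (G - {g})" unfolding rat_vs.dependent_def by blast
    then have "rat_vs.span (G - {g}) = rat_vs.span G"
      using rat_vs.span_redundant[OF g(2)] by (simp add: insert_absorb)
    then have "field_degree M \<le> card (G - {g})" using dim G(1) span by simp
    then show False using card g(1) G(1) by (metis card_Diff1_less leD order_less_le_trans)
  qed
  show "int_mod.independent G"
  proof
    assume "int_mod.dependent G"
    then obtain u where u: "\<exists>g\<in>G. u g \<noteq> 0" "(\<Sum>g\<in>G. of_int (u g) * g) = 0"
      using int_mod.dependent_finite[OF G(1)] by blast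
    have "(\<Sum>g\<in>G. of_rat (of_int (u g)) * g) = 0" using u(2) by simp
    moreover have "\<exists>g\<in>G. of_int (u g) \<noteq> (0 :: rat)" using u(1) by simp
    ultimately have "rat_vs.dependent G" unfolding rat_vs.dependent_finite[OF G(1)] by (intro exI[of _ "\<lambda>g. of_int (u g)"]) simp
    then show False using \<open>rat_vs.independent G\<close> by contradiction
  qed
qed

text \<open>Euclidean reduction applied to the coefficients of 1 produces a generator b with 1 = n
  b. Then b = 1/n is rational and integral over the integers, so b = \<plusmn>1 and 1 can take its
  place.\<close>

lemma integral_basis_with_one:
  assumes M: "number_field M"
  obtains bs where "integral_basis M (1 # bs)" "Suc (length bs) = field_degree M"
proof -
  note R = ring_of_integers_finite_subring[OF M]
  obtain gs where gs: "distinct gs" "int_mod.span (set gs) = ring_of_integers M" "rat_basis M (set gs)"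
    using finite_subring_basis[OF R] by metis
  let ?G = "set gs"
  have "1 \<in> int_mod.span ?G" using finite_subringD(1)[OF R(1)] gs(2) by simp
  then obtain u where u: "1 = (\<Sum>g\<in>?G. of_int (u g) * g)" by (auto simp: int_mod.span_finite)
  have "\<exists>g\<in>?G. u g \<noteq> 0"
  proof (rule ccontr)
    assume "\<not> ?thesis"
    then have "(\<Sum>g\<in>?G. of_int (u g) * g) = 0" by simp
    then show False using u by simp
  qed
  from int_span_reduce[OF finite_set this, folded u] gs(2)
  obtain H where H: "finite H" "int_mod.span H = ring_of_integers M" "card H \<le> card ?G"
    and or: "card H < card ?G \<or> (\<exists>b\<in>H. \<exists>n. n \<noteq> 0 \<and> 1 = of_int n * b)" by auto
  have deg: "card ?G = field_degree M" using card_rat_basis[OF gs(3)] .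
  then have "card H = field_degree M" using int_independent_if_card_le(2)[OF M H(1,2)] H(3) by simp
  then obtain b n where b: "b \<in> H" "n \<noteq> 0" "1 = of_int n * b" using or deg by auto
  have bn: "b = 1 / of_int n" using b(2,3) by (simp add: field_simps)
  have "b \<in> ring_of_integers M" using b(1) H(2) int_mod.span_base by blast
  then have "algebraic_int b" unfolding ring_of_integers_def by simp
  moreover have "b \<in> \<rat>" unfolding bn by simp
  ultimately have "b \<in> \<int>" by (rule rational_algebraic_int_is_int)
  then obtain m where m: "b = of_int m" by (rule Ints_cases)
  have "of_int (n * m) = (1 :: 'a)" using b(3) m by simp
  then have "n * m = 1" by (simp only: of_int_eq_1_iff)
  then have m1: "m = 1 \<or> m = -1" by (metis zmult_eq_1_iff)
  define H' where "H' = insert 1 (H - {b})"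
  have one: "1 \<in> ring_of_integers M" using finite_subringD(1)[OF R(1)] .
  have "H' \<subseteq> int_mod.span H"
    unfolding H'_def using one H(2) by (auto intro: int_mod.span_base)
  moreover have "H \<subseteq> int_mod.span H'"
  proof
    fix h assume "h \<in> H"
    show "h \<in> int_mod.span H'"
    proof (cases "h = b")
      case True
      have "of_int m * 1 \<in> int_mod.span H'"
        unfolding H'_def by (intro int_mod.span_scale int_mod.span_base) simp
      then show ?thesis using True m by simp
    next
      case False
      then show ?thesis using \<open>h \<in> H\<close> unfolding H'_def by (auto intro: int_mod.span_base)
    qed
  qed
  ultimately have span: "int_mod.span H' = ring_of_integers M" using H(2) by (metis int_mod.span_eq)
  have fin: "finite H'" unfolding H'_def using H(1) by simp
  have "card H' \<le> card H"
    unfolding H'_def using H(1) b(1) by (metis card_Suc_Diff1 card_insert_le_m1 diff_Suc_1 finite_Diff le_refl zero_less_Suc)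
  then have card: "card H' \<le> field_degree M" using \<open>card H = field_degree M\<close> by simp
  note indep = int_independent_if_card_le[OF M fin span card]
  obtain bs where bs: "set bs = H' - {1}" "distinct bs"
    using finite_distinct_list[of "H' - {1}"] fin by blast
  have set: "set (1 # bs) = H'" "distinct (1 # bs)" using bs unfolding H'_def by auto
  have "integral_basis M (1 # bs)"
    unfolding integral_basis_def set(1) using set(2) indep(1) span by auto
  moreover have "Suc (length bs) = field_degree M"
    using distinct_card[OF set(2)] indep(2) set(1) by simp
  ultimately show ?thesis by (rule that)
qed

section \<open>Traces from multiplication tables and small determinants\<close>

lemma field_trace_list:
  assumes M: "number_field M" and bs: "distinct bs" "rat_basis M (set bs)" and x: "x \<in> M"
    and c: "\<And>i. i < length bs \<Longrightarrow> x * bs ! i = (\<Sum>j<length bs. of_rat (c i j) * bs ! j)"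
  shows "field_trace M x = (\<Sum>i<length bs. c i i)"
proof -
  note Bs = rat_basisD[OF bs(2)]
  let ?r = "rat_vs.representation (set bs)"
  have "?r (x * bs ! i) (bs ! i) = c i i" if i: "i < length bs" for i
  proof -
    have span: "bs ! j \<in> rat_vs.span (set bs)" if "j < length bs" for j
      using that by (intro rat_vs.span_base) simp
    have "?r (x * bs ! i) (bs ! i) = (\<Sum>j<length bs. ?r (of_rat (c i j) * bs ! j) (bs ! i))"
      unfolding c[OF i] using span rat_vs.span_scale
      by (subst rat_vs.representation_sum[OF Bs(2)]) auto
    also have "\<dots> = (\<Sum>j<length bs. (if j = i then c i j else 0))"
    proof (intro sum.cong refl)
      fix j assume "j \<in> {..<length bs}"
      then have j: "j < length bs" by simp
      show "?r (of_rat (c i j) * bs ! j) (bs ! i) = (if j = i then c i j else 0)"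
        using rat_vs.representation_scale[OF Bs(2) span[OF j]]
          rat_vs.representation_basis[OF Bs(2) nth_mem[OF j]] i j bs(1)
        by (simp add: nth_eq_iff_index_eq)
    qed
    also have "\<dots> = c i i" using i by simp
    finally show ?thesis .
  qed
  then have "(\<Sum>i<length bs. ?r (x * bs ! i) (bs ! i)) = (\<Sum>i<length bs. c i i)" by simp
  moreover have "(\<Sum>b\<in>set bs. ?r (x * b) b) = (\<Sum>i<length bs. ?r (x * bs ! i) (bs ! i))"
    using bij_betw_nth[OF bs(1) refl refl] by (rule sum.reindex_bij_betw[symmetric])
  ultimately show ?thesis by (simp add: field_trace_eq[OF M bs(2) x])
qed

lemma det_mat_2:
  "det (mat 2 2 f) = f (0,0) * f (1,1) - f (0,1) * f (1,0)"
proof -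
  have one: "det (mat (Suc 0) (Suc 0) g) = g (0,0)" for g :: "nat \<times> nat \<Rightarrow> 'a"
    by (subst det_single) auto
  have "det (mat 2 2 f) = (\<Sum>i<2. mat 2 2 f $$ (i,0) * cofactor (mat 2 2 f) i 0)"
    by (rule laplace_expansion_column) auto
  also have "\<dots> = f (0,0) * f (1,1) - f (1,0) * f (0,1)"
    by (simp add: numeral_2_eq_2 cofactor_def mat_delete_def one)
  finally show ?thesis by (simp add: mult.commute)
qed

lemma det_mat_3:
  "det (mat 3 3 f) = f (0,0) * (f (1,1) * f (2,2) - f (1,2) * f (2,1))
    - f (1,0) * (f (0,1) * f (2,2) - f (0,2) * f (2,1))
    + f (2,0) * (f (0,1) * f (1,2) - f (0,2) * f (1,1))"
proof -
  have "det (mat 3 3 f) = (\<Sum>i<3. mat 3 3 f $$ (i,0) * cofactor (mat 3 3 f) i 0)"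
    by (rule laplace_expansion_column) auto
  then show ?thesis
    by (simp add: eval_nat_numeral cofactor_def mat_delete_def det_mat_2[unfolded numeral_2_eq_2] algebra_simps)
qed

section \<open>Quadratic fields\<close>

text \<open>With w^2 = m + t w the discriminant is D = t^2 + 4 m, and \<delta> = 2 w - t is a square
  root of it. A square factor k^2 with a discriminant as cofactor yields an integral element whose
  coefficient at w is 1/k.\<close>

lemma quadratic_field_discr:
  fixes F :: "'a::field_char_0 set"
  assumes F: "number_field F" and deg: "field_degree F = 2"
  shows "fundamental (field_discr F)"
proof -
  note R = ring_of_integers_finite_subring[OF F]
  define D where "D = field_discr F"
  obtain bs where bs: "integral_basis F (1 # bs)" "Suc (length bs) = 2"
    using integral_basis_with_one[OF F] deg by metis
  then obtain w where w: "bs = [w]" by (auto simp: length_Suc_conv)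
  have ib: "integral_basis F [1, w]" using bs(1) w by simp
  have dist: "distinct [1, w]" and span: "int_mod.span {1, w} = ring_of_integers F"
    using ib unfolding integral_basis_def by auto
  note rb = integral_basis_rat_basis[OF F ib]
  have int_comb: "\<exists>x y. z = of_int x + of_int y * w" if "z \<in> ring_of_integers F" for z
  proof -
    have "z \<in> int_mod.span (set [1, w])" using that span by simp
    then obtain c where "z = (\<Sum>j<length [1, w]. of_int (c j) * [1, w] ! j)" using int_span_list[OF dist] by metis
    then show ?thesis by (auto simp: numeral_2_eq_2)
  qed
  have indep: "x = 0 \<and> y = 0" if "of_rat x + of_rat y * w = 0" for x y
  proof -
    have "(\<Sum>j<length [1, w]. of_rat ((\<lambda>j. if j = 0 then x else y) j) * [1, w] ! j) = 0"
      using that by (simp add: numeral_2_eq_2)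
    from rat_independent_list[OF dist rat_basisD(2)[OF rb] this, of 0]
      rat_independent_list[OF dist rat_basisD(2)[OF rb] this, of 1] show ?thesis by simp
  qed
  have wO: "w \<in> ring_of_integers F" using span int_mod.span_base[of w "{1, w}"] by simp
  then have wF: "w \<in> F" unfolding ring_of_integers_def by simp
  obtain m t where wt: "w * w = of_int m + of_int t * w"
    using int_comb[of "w * w"] finite_subringD(2)[OF R(1) wO wO] by blast
  have tr1: "field_trace F 1 = 2" using field_trace_one[OF F] deg by simp
  have trw: "field_trace F w = of_int t"
  proof -
    have "field_trace F w = (\<Sum>i<length [1, w]. (\<lambda>i j. if i = 0 then if j = 0 then 0 else 1
        else if j = 0 then of_int m else of_int t) i i)"
      using wt by (intro field_trace_list[OF F dist rb wF]) (auto simp: numeral_2_eq_2 less_Suc_eq)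
    then show ?thesis by (simp add: numeral_2_eq_2)
  qed
  have trww: "field_trace F (w * w) = of_int (2*m + t^2)"
    unfolding wt
    using field_trace_add[OF F number_field_of_rat[OF F, of "of_int m"] number_field_scale[OF F wF, of "of_int t"]]
      field_trace_scale[OF F number_field_one[OF F], of "of_int m"] field_trace_scale[OF F wF, of "of_int t"]
    by (simp add: tr1 trw power2_eq_square)
  have "of_int D = det (trace_matrix F [1, w])" unfolding D_def using field_discr_eq[OF F ib] .
  also have "trace_matrix F [1, w] = mat 2 2 (\<lambda>(i, j). field_trace F ([1, w] ! i * [1, w] ! j))"
    unfolding trace_matrix_def by (simp add: numeral_2_eq_2)
  also have "det \<dots> = 2 * of_int (2*m + t^2) - of_int t * of_int t"
    unfolding det_mat_2 by (simp add: tr1 trw trww)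
  also have "\<dots> = of_int (t^2 + 4*m)" by (simp add: power2_eq_square)
  finally have D: "D = t^2 + 4*m" by (simp only: of_int_eq_iff)
  define \<delta> where "\<delta> = 2*w - of_int t"
  have \<delta>: "\<delta>^2 = of_int D"
  proof -
    have "\<delta>^2 = 4 * (w * w) - 4 * of_int t * w + (of_int t)^2"
      unfolding \<delta>_def by (simp add: power2_eq_square algebra_simps)
    also have "\<dots> = of_int D" unfolding D wt by (simp add: algebra_simps)
    finally show ?thesis .
  qed
  have nsq: "D \<noteq> v^2" for v
  proof
    assume "D = v^2"
    then have "\<delta>^2 = (of_int v)^2" using \<delta> by simp
    then have "\<delta> = of_int v \<or> \<delta> = of_int (- v)" by (simp add: power2_eq_iff)
    then obtain v' :: int where "\<delta> = of_int v'" by blast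
    then have "of_rat (of_int (- t - v')) + of_rat 2 * w = 0" unfolding \<delta>_def by (simp add: of_rat_diff of_rat_minus) (simp add: algebra_simps)
    then show False using indep by fastforce
  qed
  have "k^2 = 1" if kE: "D = k^2 * E" and E: "E mod 4 = 0 \<or> E mod 4 = 1" for k E
  proof -
    have k0: "k \<noteq> 0" using kE nsq[of 0] by auto
    \<comment> \<open>e is the residue 0 or 1 of E modulo 4. Its idempotence makes \<eta> below a
      root of the monic integer polynomial X^2 - e X - f.\<close>
    obtain e f where ef: "e^2 = e" "E = e + 4*f"
    proof (cases "E mod 4 = 0")
      case True
      then show ?thesis using that[of 0 "E div 4"] by auto
    next
      case False
      then show ?thesis using that[of 1 "E div 4"] E mult_div_mod_eq[of 4 E] by simp
    qed
    define \<eta> where "\<eta> = (of_int e + \<delta> / of_int k) / 2"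
    have "(\<delta> / of_int k)^2 = of_int E" using \<delta> kE k0 by (simp add: power_divide)
    moreover have "2*\<eta> - of_int e = \<delta> / of_int k"
    proof -
      have "2 * ((of_int e + x) / 2) - of_int e = x" for x :: 'a by (simp add: field_simps)
      then show ?thesis unfolding \<eta>_def .
    qed
    ultimately have sq: "(2*\<eta> - of_int e)^2 = of_int (e + 4*f)" unfolding ef(2) by simp
    have e2: "(of_int e)^2 = (of_int e :: 'a)" using ef(1) by (metis of_int_power)
    have "4 * (\<eta>^2 - of_int e * \<eta> - of_int f) = (2*\<eta> - of_int e)^2 - (of_int e)^2 - 4 * of_int f"
      by (simp add: power2_eq_square algebra_simps)
    also have "\<dots> = 0" unfolding sq e2 by simp
    finally have "4 * (\<eta>^2 - of_int e * \<eta> - of_int f) = 0" .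
    then have \<eta>: "\<eta>^2 - of_int e * \<eta> - of_int f = 0" by (simp only: mult_eq_0_iff) simp
    have "poly (map_poly of_int [:- f, - e, 1:]) \<eta> = \<eta>^2 - of_int e * \<eta> - of_int f"
      by (simp add: map_poly_pCons power2_eq_square algebra_simps)
    then have "poly (map_poly of_int [:- f, - e, 1:]) \<eta> = 0" unfolding \<eta> .
    then have "algebraic_int \<eta>"
      unfolding algebraic_int_altdef_ipoly by (intro exI[of _ "[:- f, - e, 1:]"]) simp
    moreover have "\<eta> = of_rat (of_int e / 2 - of_int t / (2 * of_int k)) + of_rat (1 / of_int k) * w"
    proof -
      have "(x + (2*w - y) / z) / 2 = (x / 2 - y / (2 * z)) + (1 / z) * w" if "z \<noteq> 0" for x y z :: 'a
        using that by (simp add: field_simps)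
      from this[of "of_int k" "of_int e" "of_int t"] k0 show ?thesis
        unfolding \<eta>_def \<delta>_def by (simp add: of_rat_diff of_rat_divide of_rat_mult)
    qed
    then have "\<eta> \<in> F"
      using number_field_add[OF F number_field_of_rat[OF F] number_field_scale[OF F wF]] by metis
    ultimately have "\<eta> \<in> ring_of_integers F" unfolding ring_of_integers_def by simp
    then obtain x y where xy: "\<eta> = of_int x + of_int y * w" using int_comb by blast
    have k0': "of_int k \<noteq> (0 :: 'a)" using k0 by simp
    have "x * z + 2 * w - y = 2 * z * ((x + (2 * w - y) / z) / 2)" if "z \<noteq> 0" for x y z :: 'a
      using that by (simp add: field_simps)
    from this[OF k0', of "of_int e" "of_int t"]
    have eq: "of_int e * of_int k + 2 * w - of_int t = 2 * of_int k * (of_int x + of_int y * w)"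
      unfolding xy[symmetric] \<eta>_def \<delta>_def .
    have "of_int (e*k - t - 2*k*x) + of_int (2 - 2*k*y) * w
        = (of_int e * of_int k + 2 * w - of_int t) - 2 * of_int k * (of_int x + of_int y * w)"
      by (simp only: of_int_diff of_int_mult of_int_numeral) Groebner_Basis.algebra
    also have "\<dots> = 0" unfolding eq by simp
    finally have "of_rat (of_int (e*k - t - 2*k*x)) + of_rat (of_int (2 - 2*k*y)) * w = 0"
      by (simp only: of_rat_of_int_eq)
    then have "of_int (2 - 2*k*y) = (0 :: rat)" using indep by blast
    then have "2 - 2*k*y = 0" by (simp only: of_int_eq_0_iff)
    then have "k * y = 1" by simp
    then have "k = 1 \<or> k = -1" by (metis zmult_eq_1_iff)
    then show ?thesis by auto
  qed
  then show ?thesis using nsq unfolding fundamental_def D_def by blast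
qed

section \<open>Index forms of cubic fields\<close>

lemma rat_independent_three:
  fixes x y z :: "'a::field_char_0"
  assumes "\<And>p q r. of_rat p * x + of_rat q * y + of_rat r * z = 0 \<Longrightarrow> p = 0 \<and> q = 0 \<and> r = 0"
  shows "rat_vs.independent {x, y, z}" and "card {x, y, z} = 3"
proof -
  have ne: "x \<noteq> y" "x \<noteq> z" "y \<noteq> z"
    using assms[of 1 "-1" 0] assms[of 1 0 "-1"] assms[of 0 1 "-1"] by auto
  then show "card {x, y, z} = 3" by simp
  show "rat_vs.independent {x, y, z}"
  proof
    assume "rat_vs.dependent {x, y, z}"
    then obtain u where u: "\<exists>v\<in>{x, y, z}. u v \<noteq> 0" "(\<Sum>v\<in>{x, y, z}. of_rat (u v) * v) = 0"
      using rat_vs.dependent_finite[of "{x, y, z}"] by auto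
    then show False using assms[of "u x" "u y" "u z"] ne by (auto simp: add.assoc)
  qed
qed

lemma rat_basis_if_card:
  assumes M: "number_field M" and B: "finite B" "rat_vs.independent B" "B \<subseteq> M" "card B = field_degree M"
  shows "rat_basis M B"
proof -
  obtain C where C: "rat_basis M C" using rat_basis_exists[OF M] .
  note Cs = rat_basisD[OF C]
  have "M \<subseteq> rat_vs.span B"
  proof
    fix x assume x: "x \<in> M"
    show "x \<in> rat_vs.span B"
    proof (rule ccontr)
      assume n: "x \<notin> rat_vs.span B"
      then have "rat_vs.independent (insert x B)" using B(2) by (rule rat_vs.independent_insertI)
      moreover have "insert x B \<subseteq> rat_vs.span C" using x B(3) Cs(3) by simp
      ultimately have "card (insert x B) \<le> card C" using rat_vs.independent_span_bound[OF Cs(1)] by blast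
      moreover have "x \<notin> B" using n rat_vs.span_base by blast
      ultimately show False using B(1,4) card_rat_basis[OF C] by simp
    qed
  qed
  moreover have "rat_vs.span B \<subseteq> M" using B(3) number_field_subspace[OF M] by (rule rat_vs.span_minimal)
  ultimately show ?thesis unfolding rat_basis_def using B(1,2) by blast
qed

lemma integral_basis_three:
  assumes K: "number_field K" and ib: "integral_basis K [1, w, t]"
  shows "x \<in> ring_of_integers K \<longleftrightarrow> (\<exists>p q r. x = of_int p + of_int q * w + of_int r * t)" (is "_ \<longleftrightarrow> ?R")
    and "of_rat p' + of_rat q' * w + of_rat r' * t = 0 \<Longrightarrow> p' = 0 \<and> q' = 0 \<and> r' = 0"
proof -
  have dist: "distinct [1, w, t]" and span: "int_mod.span {1, w, t} = ring_of_integers K"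
    using ib unfolding integral_basis_def by auto
  note rb = integral_basis_rat_basis[OF K ib]
  show "x \<in> ring_of_integers K \<longleftrightarrow> ?R"
  proof
    assume "x \<in> ring_of_integers K"
    then have "x \<in> int_mod.span (set [1, w, t])" using span by simp
    then obtain c where "x = (\<Sum>j<length [1, w, t]. of_int (c j) * [1, w, t] ! j)" using int_span_list[OF dist] by metis
    then show ?R by (auto simp: eval_nat_numeral)
  next
    assume ?R
    then obtain p q r where x: "x = of_int p * 1 + of_int q * w + of_int r * t" by auto
    show "x \<in> ring_of_integers K"
      unfolding span[symmetric] x
      by (intro int_mod.span_add int_mod.span_scale int_mod.span_base) auto
  qed
  assume eq: "of_rat p' + of_rat q' * w + of_rat r' * t = 0"
  define c where "c j = (if j = 0 then p' else if j = 1 then q' else r')" for j :: nat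
  have "(\<Sum>j<length [1, w, t]. of_rat (c j) * [1, w, t] ! j) = 0"
    using eq by (simp add: eval_nat_numeral c_def)
  note * = rat_independent_list[OF dist rat_basisD(2)[OF rb] this]
  show "p' = 0 \<and> q' = 0 \<and> r' = 0" using *[of 0] *[of 1] *[of 2] by (simp add: c_def)
qed

lemma integral_basis_three_change:
  assumes K: "number_field K" "field_degree K = 3" and ib: "integral_basis K [1, w, t]"
    and w': "w' \<in> ring_of_integers K" and t': "t' \<in> ring_of_integers K"
    and w: "w = of_int p + of_int q * w' + of_int r * t'" and t: "t = of_int p' + of_int q' * w' + of_int r' * t'"
  shows "integral_basis K [1, w', t']"
proof -
  have span: "int_mod.span {1, w, t} = ring_of_integers K" using ib unfolding integral_basis_def by simp
  have comb: "of_int m + of_int n * w' + of_int l * t' \<in> int_mod.span {1, w', t'}" for m n l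
  proof -
    have "of_int m * 1 + of_int n * w' + of_int l * t' \<in> int_mod.span {1, w', t'}"
      by (intro int_mod.span_add int_mod.span_scale int_mod.span_base) auto
    then show ?thesis by simp
  qed
  have "{1, w, t} \<subseteq> int_mod.span {1, w', t'}"
    using comb[of 1 0 0] comb[of p q r] comb[of p' q' r'] w t by simp
  moreover have "{1, w', t'} \<subseteq> int_mod.span {1, w, t}"
    using w' t' finite_subringD(1)[OF ring_of_integers_finite_subring(1)[OF K(1)]] unfolding span by simp
  ultimately have "int_mod.span {1, w', t'} = int_mod.span {1, w, t}" by (simp only: int_mod.span_eq)
  then have sp: "int_mod.span {1, w', t'} = ring_of_integers K" using span by simp
  have "card {1, w', t'} \<le> 3" by (simp add: card_insert_if)
  note * = int_independent_if_card_le[OF K(1) _ sp, unfolded K(2), OF _ this]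
  have "distinct [1, w', t']" using *(2) by (intro card_distinct) simp
  then show ?thesis unfolding integral_basis_def using *(1) sp by simp
qed

text \<open>A Delone--Faddeev basis: the index form is \<open>a x\<^sup>3 + b x\<^sup>2 y + c x y\<^sup>2 + d y\<^sup>3\<close>.\<close>

definition index_form_basis ::
  "'a::field_char_0 set \<Rightarrow> 'a \<Rightarrow> 'a \<Rightarrow> int \<Rightarrow> int \<Rightarrow> int \<Rightarrow> int \<Rightarrow> bool" where
  "index_form_basis K w t a b c d \<longleftrightarrow> integral_basis K [1, w, t] \<and>
     w * t = - (of_int a * of_int d) \<and>
     w * w = - (of_int a * of_int c) + of_int b * w - of_int a * t \<and>
     t * t = - (of_int b * of_int d) + of_int d * w - of_int c * t"

text \<open>Translating w and t by integers makes their product an integer. Associativity, in the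
  form W (W T) = (W W) T and W (T T) = (W T) T, then determines the constant terms of the
  multiplication table.\<close>

lemma index_form_basis_exists:
  assumes K: "number_field K" "field_degree K = 3" and ib: "integral_basis K [1, w, t]"
  shows "\<exists>m n a b c d. index_form_basis K (w + of_int m) (t + of_int n) a b c d"
proof -
  note O = integral_basis_three(1)[OF K(1)]
  note R = ring_of_integers_finite_subring(1)[OF K(1)]
  have wt: "w \<in> ring_of_integers K" "t \<in> ring_of_integers K"
    using O[OF ib, of w] O[OF ib, of t] by (metis (no_types) add_0 mult_1 mult_zero_left of_int_0 of_int_1 add.right_neutral)+
  obtain x y z where xyz: "w * t = of_int x + of_int y * w + of_int z * t"
    using O[OF ib] finite_subringD(2)[OF R wt] by blast
  \<comment> \<open>From w t = x + y w + z t follows (w - z) (t - y) = x + y z.\<close>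
  define W T where "W = w + of_int (- z)" and "T = t + of_int (- y)"
  have WT: "W \<in> ring_of_integers K" "T \<in> ring_of_integers K"
  proof -
    have "W = of_int (- z) + of_int 1 * w + of_int 0 * t" "T = of_int (- y) + of_int 0 * w + of_int 1 * t"
      unfolding W_def T_def by simp_all
    then show "W \<in> ring_of_integers K" "T \<in> ring_of_integers K" using O[OF ib] by blast+
  qed
  have "w = of_int z + of_int 1 * W + of_int 0 * T" "t = of_int y + of_int 0 * W + of_int 1 * T"
    unfolding W_def T_def by simp_all
  from integral_basis_three_change[OF K ib WT this] have ib': "integral_basis K [1, W, T]" .
  have WT0: "W * T = of_int (x + y * z)"
    unfolding W_def T_def using xyz by (simp add: algebra_simps)
  obtain m b a where m: "W * W = of_int m + of_int b * W + of_int a * T"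
    using O[OF ib'] finite_subringD(2)[OF R WT(1,1)] by blast
  obtain l d c where l: "T * T = of_int l + of_int d * W + of_int c * T"
    using O[OF ib'] finite_subringD(2)[OF R WT(2,2)] by blast
  define n where "n = x + y * z"
  note ind = integral_basis_three(2)[OF K(1) ib']
  have WTn: "W * T = of_int n" using WT0 unfolding n_def .
  have "of_int n * W = of_int m * T + of_int b * of_int n + of_int a * (T * T)"
  proof -
    have "n' * x = m' * y + b' * n' + a' * (y * y)"
      if "x * x = m' + b' * x + a' * y" "x * y = n'" for x y m' b' a' n' :: 'a
    proof -
      have "n' * x = x * x * y" unfolding that(2)[symmetric] by (simp only: mult_ac)
      also have "\<dots> = m' * y + b' * (x * y) + a' * (y * y)"
        unfolding that(1) by (simp add: algebra_simps)
      finally show ?thesis unfolding that(2) .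
    qed
    from this[OF m WTn] show ?thesis .
  qed
  then have "of_rat (of_int (b * n + a * l)) + of_rat (of_int (a * d - n)) * W + of_rat (of_int (m + a * c)) * T = 0"
    unfolding l by (simp add: algebra_simps of_rat_add of_rat_diff of_rat_mult of_rat_minus)
  note e1 = ind[OF this]
  have "of_int n * T = of_int l * W + of_int d * (W * W) + of_int c * of_int n"
  proof -
    have "n' * y = l' * x + d' * (x * x) + c' * n'"
      if "y * y = l' + d' * x + c' * y" "x * y = n'" for x y l' d' c' n' :: 'a
    proof -
      have "n' * y = x * (y * y)" unfolding that(2)[symmetric] by (simp only: mult_ac)
      also have "\<dots> = l' * x + d' * (x * x) + c' * (x * y)"
        unfolding that(1) by (simp add: algebra_simps)
      finally show ?thesis unfolding that(2) .
    qed
    from this[OF l WTn] show ?thesis .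
  qed
  then have "of_rat (of_int (d * m + c * n)) + of_rat (of_int (l + d * b)) * W + of_rat (of_int (d * a - n)) * T = 0"
    unfolding m by (simp add: algebra_simps of_rat_add of_rat_diff of_rat_mult of_rat_minus)
  note e2 = ind[OF this]
  have n: "n = a * d" and m': "m = - (a * c)" and l': "l = - (b * d)"
    using e1 e2 by (simp_all only: of_int_eq_0_iff) (simp_all add: algebra_simps)
  \<comment> \<open>The index form has the coefficients of T in W^2 and in T^2 with opposite
    sign.\<close>
  have "index_form_basis K W T (- a) b (- c) d"
    unfolding index_form_basis_def
    using ib' m l WTn unfolding n m' l' by simp
  then show ?thesis unfolding W_def T_def by blast
qed

context
  fixes K :: "'a::field_char_0 set" and w t a b c d
  assumes K: "number_field K" "field_degree K = 3" and I: "index_form_basis K w t a b c d"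
begin

lemma index_form_basisD:
  shows "integral_basis K [1, w, t]" "w * t = - (of_int a * of_int d)"
    "w * w = - (of_int a * of_int c) + of_int b * w - of_int a * t"
    "t * t = - (of_int b * of_int d) + of_int d * w - of_int c * t"
  using I unfolding index_form_basis_def by auto

lemma index_form_basis_in: "w \<in> K" "t \<in> K"
  using rat_basisD(4)[OF integral_basis_rat_basis[OF K(1) index_form_basisD(1)]] by auto

lemma index_form_trace: "field_trace K (of_rat p + of_rat q * w + of_rat r * t) = 3 * p + of_int b * q - of_int c * r"
proof -
  note D = index_form_basisD
  have dist: "distinct [1, w, t]" using D(1) unfolding integral_basis_def by blast
  note rb = integral_basis_rat_basis[OF K(1) D(1)]
  have tr1: "field_trace K 1 = 3" using field_trace_one[OF K(1)] K(2) by simp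
  have trw: "field_trace K w = of_int b"
  proof -
    have "field_trace K w = (\<Sum>i<length [1, w, t]. (\<lambda>i j.
        if i = 0 then if j = 1 then 1 else 0
        else if i = 1 then if j = 0 then - of_int (a * c) else if j = 1 then of_int b else - of_int a
        else if j = 0 then - of_int (a * d) else 0) i i)"
      using D(2,3) by (intro field_trace_list[OF K(1) dist rb index_form_basis_in(1)])
        (auto simp: eval_nat_numeral less_Suc_eq of_rat_minus of_rat_mult)
    then show ?thesis by (simp add: eval_nat_numeral)
  qed
  have trt: "field_trace K t = - of_int c"
  proof -
    have "field_trace K t = (\<Sum>i<length [1, w, t]. (\<lambda>i j.
        if i = 0 then if j = 2 then 1 else 0
        else if i = 1 then if j = 0 then - of_int (a * d) else 0
        else if j = 0 then - of_int (b * d) else if j = 1 then of_int d else - of_int c) i i)"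
      using D(2,4) by (intro field_trace_list[OF K(1) dist rb index_form_basis_in(2)])
        (auto simp: eval_nat_numeral less_Suc_eq of_rat_minus of_rat_mult mult.commute[of t w])
    then show ?thesis by (simp add: eval_nat_numeral)
  qed
  have in_K: "of_rat p \<in> K" "of_rat q * w \<in> K" "of_rat r * t \<in> K"
    using number_field_of_rat[OF K(1)] number_field_scale[OF K(1)] index_form_basis_in by auto
  have "field_trace K (of_rat p) = 3 * p"
    using field_trace_scale[OF K(1) number_field_one[OF K(1)], of p] tr1 by simp
  then show ?thesis
    using in_K number_field_add[OF K(1)] index_form_basis_in
    by (simp add: field_trace_add[OF K(1)] field_trace_scale[OF K(1)] trw trt)
qed

text \<open>The value is the discriminant of the binary cubic form with coefficients (a, b, c,
  d).\<close>

lemma index_form_discr: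
  "field_discr K = b^2 * c^2 - 4*a*c^3 - 4*b^3*d - 27*a^2*d^2 + 18*a*b*c*d"
proof -
  note D = index_form_basisD
  have one: "field_trace K 1 = 3" and w: "field_trace K w = of_int b" and t: "field_trace K t = - of_int c"
    using index_form_trace[of 1 0 0] index_form_trace[of 0 1 0] index_form_trace[of 0 0 1] by simp_all
  have ww: "field_trace K (w * w) = of_int (b^2 - 2*a*c)"
  proof -
    have "w * w = of_rat (of_int (- (a*c))) + of_rat (of_int b) * w + of_rat (of_int (- a)) * t"
      unfolding D(3) by (simp add: of_rat_minus of_rat_mult)
    then show ?thesis by (simp only: index_form_trace) (simp add: power2_eq_square)
  qed
  have wt: "field_trace K (w * t) = of_int (- 3*a*d)"
  proof -
    have "w * t = of_rat (of_int (- (a*d))) + of_rat (of_int 0) * w + of_rat (of_int 0) * t"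
      unfolding D(2) by (simp add: of_rat_minus of_rat_mult)
    then show ?thesis by (simp only: index_form_trace)
  qed
  have tt: "field_trace K (t * t) = of_int (c^2 - 2*b*d)"
  proof -
    have "t * t = of_rat (of_int (- (b*d))) + of_rat (of_int d) * w + of_rat (of_int (- c)) * t"
      unfolding D(4) by (simp add: of_rat_minus of_rat_mult)
    then show ?thesis by (simp only: index_form_trace) (simp add: power2_eq_square)
  qed
  have "of_int (field_discr K) = det (trace_matrix K [1, w, t])" using field_discr_eq[OF K(1) D(1)] .
  also have "trace_matrix K [1, w, t] = mat 3 3 (\<lambda>(i, j). field_trace K ([1, w, t] ! i * [1, w, t] ! j))"
    unfolding trace_matrix_def by (simp add: eval_nat_numeral)
  also have "det \<dots> = of_int (3 * ((b^2 - 2*a*c) * (c^2 - 2*b*d) - (- 3*a*d) * (- 3*a*d))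
      - b * (b * (c^2 - 2*b*d) - (- c) * (- 3*a*d)) + (- c) * (b * (- 3*a*d) - (- c) * (b^2 - 2*a*c)))"
  proof -
    have tw: "field_trace K (t * w) = of_int (- 3*a*d)" using wt by (simp only: mult.commute)
    have nth: "[1, w, t] ! 0 = 1" "[1, w, t] ! 1 = w" "[1, w, t] ! 2 = t" by simp_all
    show ?thesis
      by (simp only: det_mat_3 prod.case nth mult_1_left mult_1_right one w t ww wt tw tt of_int_add of_int_diff
          of_int_mult of_int_minus of_int_numeral)
  qed
  finally have "field_discr K = 3 * ((b^2 - 2*a*c) * (c^2 - 2*b*d) - (- 3*a*d) * (- 3*a*d))
      - b * (b * (c^2 - 2*b*d) - (- c) * (- 3*a*d)) + (- c) * (b * (- 3*a*d) - (- c) * (b^2 - 2*a*c))"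
    by (simp only: of_int_eq_iff)
  then show ?thesis by (simp add: power2_eq_square power3_eq_cube algebra_simps)
qed

end

text \<open>The third coefficient of the index form is minus the trace of t, so it suffices to
  choose t with trace divisible by 3. The second coefficient is the trace of w: were it divisible by
  3 too, 9 would divide the discriminant.\<close>

lemma adapted_basis_exists:
  assumes K: "number_field K" "field_degree K = 3" and nine: "\<not> 9 dvd field_discr K"
  obtains w t a b c d where "index_form_basis K w t a b (3 * c) d" "\<not> 3 dvd b"
proof -
  note outer = that
  note R = ring_of_integers_finite_subring(1)[OF K(1)]
  obtain bs where bs: "integral_basis K (1 # bs)" "Suc (length bs) = 3"
    using integral_basis_with_one[OF K(1)] K(2) by metis
  then obtain v0 t0 where "bs = [v0, t0]" by (auto simp: length_Suc_conv eval_nat_numeral)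
  then have "integral_basis K [1, v0, t0]" using bs(1) by simp
  then obtain w0 s0 a0 b0 c0 d0 where I0: "index_form_basis K w0 s0 a0 b0 c0 d0"
    using index_form_basis_exists[OF K] by blast
  note ib = index_form_basisD(1)[OF K I0]
  note O = integral_basis_three(1)[OF K(1) ib]
  have comb: "of_int p + of_int q * w0 + of_int r * s0 \<in> ring_of_integers K" for p q r using O by blast
  have tr: "field_trace K (of_int q * w0 + of_int r * s0 + of_int n) = of_int (3 * n + b0 * q - c0 * r)" for q r n
    using index_form_trace[OF K I0, of "of_int n" "of_int q" "of_int r"] by (simp add: algebra_simps)
  have fin: ?thesis if ib: "integral_basis K [1, v, of_int q * w0 + of_int r * s0]" and dv: "3 dvd b0 * q - c0 * r"
    for v q r
  proof -
    obtain m n a b c d where I: "index_form_basis K (v + of_int m) (of_int q * w0 + of_int r * s0 + of_int n) a b c d"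
      using index_form_basis_exists[OF K ib] by blast
    have "of_int (3 * n + b0 * q - c0 * r) = (- of_int c :: rat)"
      using tr[of q r n] index_form_trace[OF K I, of 0 0 1] by simp
    then have "3 * n + b0 * q - c0 * r = - c" by (simp only: of_int_minus[symmetric] of_int_eq_iff)
    then have "c = - (3 * n + (b0 * q - c0 * r))" by simp
    moreover have "3 dvd 3 * n + (b0 * q - c0 * r)" using dv by (intro dvd_add dvd_triv_left)
    ultimately have "3 dvd c" by (simp only: dvd_minus_iff)
    then obtain c1 where c: "c = 3 * c1" by blast
    have "\<not> 3 dvd b"
    proof
      assume "3 dvd b"
      then obtain b1 where "b = 3 * b1" by blast
      then have "field_discr K = 9 * (9*b1^2*c1^2 - 12*a*c1^3 - 12*b1^3*d - 3*a^2*d^2 + 18*a*b1*c1*d)"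
        unfolding index_form_discr[OF K I] c by (simp add: power_mult_distrib algebra_simps)
      then show False using nine by simp
    qed
    then show ?thesis by (rule outer[OF I[unfolded c]])
  qed
  \<comment> \<open>Modulo 3 the trace is a linear form in (q, r), so it vanishes at one of the four
    points of the projective line over the field with three elements. Each point below is completed
    to an integral basis.\<close>
  have "3 dvd c0 \<or> 3 dvd b0 \<or> 3 dvd b0 - c0 \<or> 3 dvd b0 + c0" by presburger
  then consider "3 dvd c0" | "3 dvd b0" | "3 dvd b0 - c0" | "3 dvd b0 + c0" by blast
  then show ?thesis
  proof cases
    case 1
    show ?thesis by (rule fin[of w0 0 1]) (use ib 1 in simp_all)
  next
    case 2
    have "integral_basis K [1, s0, w0]"
      by (rule integral_basis_three_change[OF K ib, where p = 0 and q = 0 and r = 1 and p' = 0 and q' = 1 and r' = 0])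
        (use comb[of 0 1 0] comb[of 0 0 1] in simp_all)
    then show ?thesis by (intro fin[of s0 1 0]) (use 2 in simp_all)
  next
    case 3
    have "integral_basis K [1, w0, w0 + s0]"
      by (rule integral_basis_three_change[OF K ib, where p = 0 and q = 1 and r = 0 and p' = 0 and q' = "-1" and r' = 1])
        (use comb[of 0 1 0] comb[of 0 1 1] in simp_all)
    then show ?thesis by (intro fin[of w0 1 1]) (use 3 in simp_all)
  next
    case 4
    have "integral_basis K [1, w0, w0 - s0]"
      by (rule integral_basis_three_change[OF K ib, where p = 0 and q = 1 and r = 0 and p' = 0 and q' = 1 and r' = "-1"])
        (use comb[of 0 1 0] comb[of 0 1 "-1"] in simp_all)
    then show ?thesis by (intro fin[of w0 1 "-1"]) (use 4 in simp_all)
  qed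
qed

section \<open>The trace zero module of a cubic field\<close>

text \<open>One third of the Hessian of the index form (a, b, 3c, d), taken at (3x, y).\<close>

definition half_trace_form :: "int \<Rightarrow> int \<Rightarrow> int \<Rightarrow> int \<Rightarrow> int \<Rightarrow> int \<Rightarrow> int" where
  "half_trace_form a b c d x y =
     3*(b^2 - 9*a*c)*x^2 + 3*(b*c - 3*a*d)*x*y + (3*c^2 - b*d)*y^2"

text \<open>The norm of a trace zero element; up to a factor 27, the cubic covariant of the index
  form (a, b, 3c, d) at (3x, y).\<close>

definition norm_form :: "int \<Rightarrow> int \<Rightarrow> int \<Rightarrow> int \<Rightarrow> int \<Rightarrow> int \<Rightarrow> int" where
  "norm_form a b c d x y = (2*b^3 - 27*a*b*c + 27*a^2*d)*x^3 + (3*b^2*c + 9*a*b*d - 54*a*c^2)*x^2*y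
     - (3*b*c^2 + 9*a*c*d - 2*b^2*d)*x*y^2 - (2*c^3 + a*d^2 - b*c*d)*y^3"

text \<open>The index form (a, b, 3c, d) at (3x, y): a trace zero vector has coefficient 3x at w and
  y at t.\<close>

definition restricted_index_form :: "int \<Rightarrow> int \<Rightarrow> int \<Rightarrow> int \<Rightarrow> int \<Rightarrow> int \<Rightarrow> int" where
  "restricted_index_form a b c d x y = 27*a*x^3 + 9*b*x^2*y + 9*c*x*y^2 + d*y^3"

text \<open>An instance of the classical syzygy between a binary cubic, its Hessian and its cubic
  covariant.\<close>

lemma form_syzygy:
  "4 * half_trace_form a b c d x y ^ 3 - 27 * norm_form a b c d x y ^ 2
    = (4*(b^2 - 9*a*c)*(3*c^2 - b*d) - 3*(b*c - 3*a*d)^2) * restricted_index_form a b c d x y ^ 2"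
  unfolding half_trace_form_def norm_form_def restricted_index_form_def
  by Groebner_Basis.algebra

context
  fixes K :: "'a::field_char_0 set" and w t a b c d
  assumes K: "number_field K" "field_degree K = 3" and I: "index_form_basis K w t a b (3 * c) d"
begin

definition trace_zero_vec :: "int \<Rightarrow> int \<Rightarrow> 'a" where
  "trace_zero_vec x y = of_int x * (3 * w - of_int b) + of_int y * (t + of_int c)"

lemma index_form_mult:
  "(of_int p + of_int q * w + of_int r * t) * (of_int p' + of_int q' * w + of_int r' * t)
    = of_int (p*p' - 3*q*q'*a*c - (q*r' + r*q')*a*d - r*r'*b*d)
      + of_int (p*q' + q*p' + b*q*q' + d*r*r') * w + of_int (p*r' + r*p' - a*q*q' - 3*c*r*r') * t"
proof -
  have "(P + Q * w + R * t) * (P' + Q' * w + R' * t)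
    = (P*P' - 3*Q*Q'*of_int a*of_int c - (Q*R' + R*Q')*of_int a*of_int d - R*R'*of_int b*of_int d)
      + (P*Q' + Q*P' + of_int b*Q*Q' + of_int d*R*R') * w + (P*R' + R*P' - of_int a*Q*Q' - 3*of_int c*R*R') * t"
    for P Q R P' Q' R' :: 'a
    using index_form_basisD(2-4)[OF K I, unfolded of_int_mult of_int_numeral] by Groebner_Basis.algebra
  then show ?thesis by (simp only: of_int_add of_int_diff of_int_mult of_int_numeral)
qed

lemma trace_zero_vec_eq:
  "trace_zero_vec x y = of_int (c*y - b*x) + of_int (3*x) * w + of_int y * t"
  unfolding trace_zero_vec_def by (simp add: algebra_simps)

lemma index_form_trace_int:
  "field_trace K (of_int p + of_int q * w + of_int r * t) = of_int (3 * p + b * q - 3 * c * r)"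
  using index_form_trace[OF K I, of "of_int p" "of_int q" "of_int r"] by simp

lemma trace_zero_vec_eq_0_iff: "trace_zero_vec x y = 0 \<longleftrightarrow> x = 0 \<and> y = 0"
proof
  assume "trace_zero_vec x y = 0"
  then have "of_rat (of_int (c*y - b*x)) + of_rat (of_int (3*x)) * w + of_rat (of_int y) * t = 0"
    unfolding trace_zero_vec_eq by (simp only: of_rat_of_int_eq)
  from integral_basis_three(2)[OF K(1) index_form_basisD(1)[OF K I] this]
  show "x = 0 \<and> y = 0" by (simp only: of_int_eq_0_iff) simp
qed (simp add: trace_zero_vec_def)

text \<open>The trace of p + q w + r t is 3 p + b q - 3 c r. If it vanishes then 3 divides b q,
  hence q because b is prime to 3.\<close>

lemma trace_zero_module_eq:
  assumes b: "\<not> 3 dvd b"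
  shows "trace_zero_module K = {trace_zero_vec x y | x y. True}"
proof (intro equalityI subsetI)
  note O = integral_basis_three(1)[OF K(1) index_form_basisD(1)[OF K I]]
  {
    fix z assume "z \<in> trace_zero_module K"
    then have z: "z \<in> ring_of_integers K" "field_trace K z = 0" unfolding trace_zero_module_def by auto
    then obtain p q r where pqr: "z = of_int p + of_int q * w + of_int r * t" using O by blast
    have "3 * p + b * q - 3 * c * r = 0"
      using z(2) unfolding pqr index_form_trace_int by (simp only: of_int_eq_0_iff)
    then have "b * q = 3 * (c * r - p)" by (simp add: algebra_simps)
    then have "3 dvd b * q" by simp
    then have "3 dvd q" using b by (simp add: prime_dvd_mult_iff)
    then obtain x where x: "q = 3 * x" by blast
    then have "p = c * r - b * x" using \<open>b * q = 3 * (c * r - p)\<close> by simp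
    then have "z = trace_zero_vec x r" unfolding pqr trace_zero_vec_eq x by simp
    then show "z \<in> {trace_zero_vec x y | x y. True}" by blast
  next
    fix z assume "z \<in> {trace_zero_vec x y | x y. True}"
    then obtain x y where z: "z = of_int (c*y - b*x) + of_int (3*x) * w + of_int y * t"
      unfolding trace_zero_vec_eq by blast
    then have "z \<in> ring_of_integers K" using O by blast
    moreover have "field_trace K z = 0" unfolding z index_form_trace_int by (simp add: algebra_simps)
    ultimately show "z \<in> trace_zero_module K" unfolding trace_zero_module_def by simp
  }
qed

lemma trace_form_trace_zero_vec:
  "trace_form K (trace_zero_vec x y) = of_int (2 * half_trace_form a b c d x y)"
proof -
  have "3 * ((c*y - b*x)*(c*y - b*x) - 3*(3*x)*(3*x)*a*c - ((3*x)*y + y*(3*x))*a*d - y*y*b*d)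
      + b * ((c*y - b*x)*(3*x) + (3*x)*(c*y - b*x) + b*(3*x)*(3*x) + d*y*y)
      - 3 * c * ((c*y - b*x)*y + y*(c*y - b*x) - a*(3*x)*(3*x) - 3*c*y*y)
      = 2 * half_trace_form a b c d x y"
    unfolding half_trace_form_def by (simp add: power2_eq_square algebra_simps)
  then show ?thesis
    unfolding trace_form_def power2_eq_square trace_zero_vec_eq index_form_mult index_form_trace_int
    by (simp only:)
qed

text \<open>Cayley-Hamilton for an element of trace zero, verified by comparing the coordinates of
  the cube at 1, w and t.\<close>

lemma trace_zero_vec_cube:
  "trace_zero_vec x y ^ 3
    = of_int (half_trace_form a b c d x y) * trace_zero_vec x y + of_int (norm_form a b c d x y)"
proof -
  define p q r where "p = (c*y - b*x)*(c*y - b*x) - 3*(3*x)*(3*x)*a*c - ((3*x)*y + y*(3*x))*a*d - y*y*b*d"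
    and "q = (c*y - b*x)*(3*x) + (3*x)*(c*y - b*x) + b*(3*x)*(3*x) + d*y*y"
    and "r = (c*y - b*x)*y + y*(c*y - b*x) - a*(3*x)*(3*x) - 3*c*y*y"
  have sq: "trace_zero_vec x y * trace_zero_vec x y = of_int p + of_int q * w + of_int r * t"
    unfolding trace_zero_vec_eq index_form_mult p_def q_def r_def ..
  have "trace_zero_vec x y ^ 3 = (trace_zero_vec x y * trace_zero_vec x y) * trace_zero_vec x y"
    by (simp add: power3_eq_cube)
  also have "\<dots> = of_int (p*(c*y - b*x) - 3*q*(3*x)*a*c - (q*y + r*(3*x))*a*d - r*y*b*d)
      + of_int (p*(3*x) + q*(c*y - b*x) + b*q*(3*x) + d*r*y) * w
      + of_int (p*y + r*(c*y - b*x) - a*q*(3*x) - 3*c*r*y) * t"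
    unfolding sq unfolding trace_zero_vec_eq index_form_mult ..
  also have "p*(c*y - b*x) - 3*q*(3*x)*a*c - (q*y + r*(3*x))*a*d - r*y*b*d
      = half_trace_form a b c d x y * (c*y - b*x) + norm_form a b c d x y"
    unfolding p_def q_def r_def half_trace_form_def norm_form_def
    by Groebner_Basis.algebra
  also have "p*(3*x) + q*(c*y - b*x) + b*q*(3*x) + d*r*y = half_trace_form a b c d x y * (3*x)"
    unfolding p_def q_def r_def half_trace_form_def
    by Groebner_Basis.algebra
  also have "p*y + r*(c*y - b*x) - a*q*(3*x) - 3*c*r*y = half_trace_form a b c d x y * y"
    unfolding p_def q_def r_def half_trace_form_def
    by Groebner_Basis.algebra
  also have "of_int (h * p' + n) + of_int (h * q') * w + of_int (h * r') * t
      = of_int h * (of_int p' + of_int q' * w + of_int r' * t) + of_int n" for h n p' q' r'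
    by (simp add: algebra_simps)
  finally show ?thesis unfolding trace_zero_vec_eq .
qed

lemma field_discr_trace_zero:
  "field_discr K = 4*(b^2 - 9*a*c)*(3*c^2 - b*d) - 3*(b*c - 3*a*d)^2"
  unfolding index_form_discr[OF K I] by (simp add: power2_eq_square power3_eq_cube algebra_simps)

lemma trace_zero_vec_props:
  "trace_zero_vec x y \<in> K" "field_trace K (trace_zero_vec x y) = 0"
proof -
  show "field_trace K (trace_zero_vec x y) = 0"
    unfolding trace_zero_vec_eq index_form_trace_int by (simp add: algebra_simps)
  show "trace_zero_vec x y \<in> K"
    using integral_basis_three(1)[OF K(1) index_form_basisD(1)[OF K I]]
    unfolding trace_zero_vec_eq ring_of_integers_def by blast
qed

end

lemma trace_zero_not_rational:
  assumes K: "number_field K" and "field_trace K x = 0" and "x = of_rat q"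
  shows "x = 0"
proof -
  have "q * of_nat (field_degree K) = 0"
    using field_trace_scale[OF K number_field_one[OF K], of q] field_trace_one[OF K] assms(2,3) by simp
  then show ?thesis using field_degree_pos[OF K] assms(3) by simp
qed

text \<open>For discriminant 12 the half trace form is 3 times a definite form of discriminant -4,
  so it takes the value 3 and some \<beta> satisfies \<beta>^3 = 3 \<beta> + N. The syzygy bounds
  |N| by 2. Odd N fails by parity, N = 0 gives \<beta>^2 = 3, whose trace would be both 6 and 9, and
  N = \<plusmn>2 makes the cubic split over the rationals.\<close>

lemma cubic_discr_neq_12:
  assumes K: "number_field K" "field_degree K = 3" and nine: "\<not> 9 dvd field_discr K"
  shows "field_discr K \<noteq> 12"
proof
  assume 12: "field_discr K = 12"
  obtain w t a b c d where I: "index_form_basis K w t a b (3 * c) d" and b: "\<not> 3 dvd b"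
    using adapted_basis_exists[OF K nine] .
  define A B C where "A = b^2 - 9*a*c" and "B = b*c - 3*a*d" and "C = 3*c^2 - b*d"
  have ABC: "4*A*C - 3*B^2 = 12"
    using field_discr_trace_zero[OF K I] 12 unfolding A_def B_def C_def by simp
  have "\<not> 3 dvd A" unfolding A_def using not_three_dvd_square_minus(1)[OF b, of "a*c"] by (simp add: mult.assoc)
  moreover have "A * C = 3 * (4 + B^2 - A * C)" using ABC by simp
  then have "3 dvd A * C" by (metis dvd_triv_left)
  ultimately have "3 dvd C" by (simp add: prime_dvd_mult_iff)
  then obtain E where E: "C = 3 * E" by blast
  have AE: "4 * (A * E) = B^2 + 4" using ABC E by simp
  then have "B^2 = 4 * (A * E) - 4" by simp
  then have "even (B^2)" by simp
  then obtain k where k: "B = 2 * k" by auto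
  have AEk: "A * E = k^2 + 1" using AE k by (simp add: power_mult_distrib)
  let ?Q = "half_trace_form a b c d" and ?N = "norm_form a b c d" and ?F = "restricted_index_form a b c d"
  have Q: "?Q x y = 3 * (A*x^2 + 2*k*x*y + E*y^2)" for x y
    unfolding half_trace_form_def A_def[symmetric] B_def[symmetric] C_def[symmetric] E k
    by (simp add: algebra_simps)
  have syz: "4 * ?Q x y ^ 3 - 27 * ?N x y ^ 2 = 12 * ?F x y ^ 2" for x y
    unfolding form_syzygy using field_discr_trace_zero[OF K I] 12 by simp
  \<comment> \<open>A negative definite form would take the value -3, where the left side of the
    syzygy is negative and the right side is not.\<close>
  have pos: "A > 0"
  proof (rule ccontr)
    assume "\<not> A > 0"
    have "A * E > 0" unfolding AEk by (simp add: add_nonneg_pos)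
    then have "- A > 0" "- E > 0" using \<open>\<not> A > 0\<close> by (auto simp: zero_less_mult_iff)
    moreover have "(- A) * (- E) = (- k)^2 + 1" using AEk by simp
    ultimately obtain x y where "(- A)*x^2 + 2*(- k)*x*y + (- E)*y^2 = 1"
      using disc_minus_four_represents_one by blast
    then have "?Q x y = -3" unfolding Q by simp
    then have "-108 - 27 * ?N x y ^ 2 = 12 * ?F x y ^ 2" using syz[of x y] by simp
    moreover have "?N x y ^ 2 \<ge> 0" "?F x y ^ 2 \<ge> 0" by auto
    ultimately show False by linarith
  qed
  have "A * E > 0" unfolding AEk by (simp add: add_nonneg_pos)
  then have "E > 0" using pos by (simp add: zero_less_mult_iff)
  then obtain x y where "A*x^2 + 2*k*x*y + E*y^2 = 1"
    using disc_minus_four_represents_one[OF pos _ AEk] by blast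
  then have Q3: "?Q x y = 3" unfolding Q by simp
  let ?\<beta> = "trace_zero_vec w t b c x y"
  have \<beta>: "?\<beta> ^ 3 = 3 * ?\<beta> + of_int (?N x y)" using trace_zero_vec_cube[OF K I, of x y] Q3 by simp
  have "?\<beta> \<noteq> 0" using trace_zero_vec_eq_0_iff[OF K I, of x y] Q3 by (auto simp: half_trace_form_def)
  note props = trace_zero_vec_props[OF K I, of x y]
  have nr: "?\<beta> \<noteq> of_rat q" for q using trace_zero_not_rational[OF K(1) props(2)] \<open>?\<beta> \<noteq> 0\<close> by blast
  have sq: "?\<beta>^2 \<noteq> 3"
  proof
    assume "?\<beta>^2 = 3"
    then have "field_trace K (of_rat 3 * 1) = 6"
      using trace_form_trace_zero_vec[OF K I, of x y] Q3 unfolding trace_form_def by simp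
    then show False
      using field_trace_scale[OF K(1) number_field_one[OF K(1)], of 3] field_trace_one[OF K(1)] K(2) by simp
  qed
  have s: "9 * (4 - ?N x y ^ 2) = 4 * ?F x y ^ 2" using syz[of x y] Q3 by simp
  have "n \<le> 4" if "9 * (4 - n) = 4 * f" "0 \<le> f" for n f :: int using that by presburger
  from this[OF s zero_le_power2] have "?N x y ^ 2 \<le> 4" .
  then have "\<bar>?N x y\<bar> \<le> 2" by (metis abs_le_square_iff abs_numeral power2_eq_square mult_2 numeral_Bit0)
  then have "?N x y = -2 \<or> ?N x y = -1 \<or> ?N x y = 0 \<or> ?N x y = 1 \<or> ?N x y = 2" by arith
  then consider "?N x y ^ 2 = 1" | "?N x y = 0" | "?N x y = 2" | "?N x y = -2" by fastforce
  then show False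
  proof cases
    case 1
    then have "27 = 4 * ?F x y ^ 2" using s by simp
    then have "even (27 :: int)" by (metis dvd_mult2 even_numeral)
    then show False by simp
  next
    case 2
    then have "?\<beta> * (?\<beta>^2 - 3) = 0" using \<beta> by (simp add: power2_eq_square power3_eq_cube algebra_simps)
    then show False using \<open>?\<beta> \<noteq> 0\<close> sq by simp
  next
    case 3
    then have "(?\<beta> - 2) * ((?\<beta> + 1) * (?\<beta> + 1)) = 0" using \<beta> by (simp add: power3_eq_cube algebra_simps)
    then have "?\<beta> = of_rat 2 \<or> ?\<beta> = of_rat (-1)" by (simp add: eq_neg_iff_add_eq_0 of_rat_minus)
    then show False using nr by blast
  next
    case 4
    then have "(?\<beta> + 2) * ((?\<beta> - 1) * (?\<beta> - 1)) = 0" using \<beta> by (simp add: power3_eq_cube algebra_simps)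
    then have "?\<beta> = of_rat (-2) \<or> ?\<beta> = of_rat 1" by (simp add: eq_neg_iff_add_eq_0 of_rat_minus)
    then show False using nr by blast
  qed
qed

section \<open>Recovering the field\<close>

lemma trace_zero_linear_independent:
  assumes K: "number_field K" and \<beta>: "field_trace K \<beta> = 0" "\<beta> \<noteq> 0"
    and eq: "of_rat p + of_rat q * \<beta> = 0"
  shows "p = 0 \<and> q = 0"
proof (cases "q = 0")
  case False
  have "of_rat q * \<beta> = of_rat (- p)" using eq by (simp add: of_rat_minus add_eq_0_iff)
  then have "\<beta> = of_rat (- p) / of_rat q" using False by (simp add: eq_divide_eq mult.commute)
  then have "\<beta> = of_rat (- p / q)" by (simp only: of_rat_divide)
  then show ?thesis using trace_zero_not_rational[OF K \<beta>(1)] \<beta>(2) by blast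
qed (use eq in simp)

text \<open>If \<open>\<beta>\<^sup>2 = s \<beta> + t\<close>, comparing traces gives \<open>t = 2 s\<^sup>2\<close>, so that
  \<open>\<beta>\<^sup>3 - Q \<beta> - N = (\<beta> - 2 s) (\<beta> + s)\<^sup>2\<close>.\<close>

lemma trace_zero_powers_independent:
  assumes K: "number_field K" "field_degree K = 3"
    and \<beta>: "\<beta> \<in> K" "field_trace K \<beta> = 0" "\<beta> \<noteq> 0"
    and sq: "field_trace K (\<beta>^2) = 2 * of_int Q" and cube: "\<beta>^3 = of_int Q * \<beta> + of_int N"
    and eq: "of_rat p * 1 + of_rat q * \<beta> + of_rat r * \<beta>^2 = 0"
  shows "p = 0 \<and> q = 0 \<and> r = 0"
proof (cases "r = 0")
  case True
  then show ?thesis using trace_zero_linear_independent[OF K(1) \<beta>(2,3), of p q] eq by simp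
next
  case False
  define s t where "s = - q / r" and "t = - p / r"
  have \<beta>2: "\<beta>^2 = of_rat s * \<beta> + of_rat t"
  proof -
    have "of_rat r * \<beta>^2 = of_rat (- q) * \<beta> + of_rat (- p)"
      using eq by (simp add: of_rat_minus) Groebner_Basis.algebra
    moreover have "of_rat (- q) = (of_rat r * of_rat s :: 'a)" "of_rat (- p) = (of_rat r * of_rat t :: 'a)"
      unfolding s_def t_def using False by (simp_all flip: of_rat_mult)
    ultimately have "of_rat r * \<beta>^2 = of_rat r * (of_rat s * \<beta> + of_rat t)" by (simp only: distrib_left mult.assoc)
    then show ?thesis using False by simp
  qed
  have "field_trace K (\<beta>^2) = field_trace K (of_rat s * \<beta> + of_rat t * 1)" using \<beta>2 by simp
  also have "\<dots> = 3 * t"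
    using field_trace_add[OF K(1) number_field_scale[OF K(1) \<beta>(1)] number_field_scale[OF K(1) number_field_one[OF K(1)]], of s t]
      field_trace_scale[OF K(1) \<beta>(1), of s] field_trace_scale[OF K(1) number_field_one[OF K(1)], of t]
      field_trace_one[OF K(1)] K(2) \<beta>(2) by simp
  finally have Qt: "2 * of_int Q = 3 * t" using sq by simp
  have "\<beta>^3 = of_rat s * \<beta>^2 + of_rat t * \<beta>"
    using \<beta>2 by Groebner_Basis.algebra
  then have "of_int Q * \<beta> + of_int N = (of_rat s * of_rat s + of_rat t) * \<beta> + of_rat s * of_rat t"
    using \<beta>2 cube by Groebner_Basis.algebra
  then have "of_rat (s * t - of_int N) + of_rat (s * s + t - of_int Q) * \<beta> = 0"
    by (simp only: of_rat_diff of_rat_add of_rat_mult of_rat_of_int_eq) Groebner_Basis.algebra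
  from trace_zero_linear_independent[OF K(1) \<beta>(2,3) this]
  have N: "of_int N = s * t" and Q: "of_int Q = s * s + t" by simp_all
  have t: "t = 2 * s * s" using Qt Q by simp
  have Q': "of_int Q = 3 * of_rat s * (of_rat s :: 'a)" and N': "of_int N = 2 * of_rat s * of_rat s * (of_rat s :: 'a)"
  proof -
    have "of_int Q = 3 * s * s" "of_int N = 2 * s * s * s" using Q N t by simp_all
    then have "of_rat (of_int Q) = (of_rat (3 * s * s) :: 'a)" "of_rat (of_int N) = (of_rat (2 * s * s * s) :: 'a)"
      by simp_all
    then show "of_int Q = 3 * of_rat s * (of_rat s :: 'a)" "of_int N = 2 * of_rat s * of_rat s * (of_rat s :: 'a)"
      by (simp_all only: of_rat_of_int_eq of_rat_mult of_rat_numeral_eq)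
  qed
  have "(\<beta> - 2 * of_rat s) * ((\<beta> + of_rat s) * (\<beta> + of_rat s)) = 0"
    using cube unfolding Q' N' by Groebner_Basis.algebra
  then consider "\<beta> = 2 * of_rat s" | "\<beta> = - of_rat s" by (auto simp: add_eq_0_iff)
  then obtain x where "\<beta> = of_rat x"
    by cases (metis of_rat_mult of_rat_numeral_eq, metis of_rat_minus)
  then show ?thesis using trace_zero_not_rational[OF K(1) \<beta>(2)] \<beta>(3) by blast
qed

lemma trace_zero_power_basis:
  assumes K: "number_field K" "field_degree K = 3"
    and \<beta>: "\<beta> \<in> K" "field_trace K \<beta> = 0" "\<beta> \<noteq> 0"
    and sq: "field_trace K (\<beta>^2) = 2 * of_int Q" and cube: "\<beta>^3 = of_int Q * \<beta> + of_int N"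
  shows "x \<in> K \<longleftrightarrow> (\<exists>p q r. x = of_rat p + of_rat q * \<beta> + of_rat r * \<beta>^2)" (is "_ \<longleftrightarrow> ?R")
    and "of_rat p + of_rat q * \<beta> + of_rat r * \<beta>^2 = of_rat p' + of_rat q' * \<beta> + of_rat r' * \<beta>^2 \<longleftrightarrow>
      p = p' \<and> q = q' \<and> r = r'"
proof -
  note ind = trace_zero_powers_independent[OF K \<beta> sq cube]
  have in_K: "{1, \<beta>, \<beta>^2} \<subseteq> K"
    using number_field_one[OF K(1)] \<beta>(1) number_field_mult[OF K(1)] by (simp add: power2_eq_square)
  have "card {1, \<beta>, \<beta>^2} = field_degree K" "rat_vs.independent {1, \<beta>, \<beta>^2}"
    using rat_independent_three[of 1 \<beta> "\<beta>^2", OF ind] K(2) by simp_all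
  then have rb: "rat_basis K {1, \<beta>, \<beta>^2}" using in_K by (intro rat_basis_if_card[OF K(1)]) auto
  show "x \<in> K \<longleftrightarrow> ?R"
  proof
    assume "x \<in> K"
    then have "x \<in> rat_vs.span {1, \<beta>, \<beta>^2}" using rat_basisD(3)[OF rb] by simp
    then obtain p where "x - of_rat p * 1 \<in> rat_vs.span {\<beta>, \<beta>^2}"
      unfolding rat_vs.span_insert[of 1] by blast
    then obtain q where "x - of_rat p * 1 - of_rat q * \<beta> \<in> rat_vs.span {\<beta>^2}"
      unfolding rat_vs.span_insert[of \<beta>] by blast
    then obtain r where "x - of_rat p * 1 - of_rat q * \<beta> = of_rat r * \<beta>^2"
      unfolding rat_vs.span_singleton by blast
    then have "x = of_rat p + of_rat q * \<beta> + of_rat r * \<beta>^2" by (simp add: diff_eq_eq add_ac)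
    then show ?R by blast
  next
    assume ?R
    then show "x \<in> K"
      using in_K number_field_of_rat[OF K(1)] number_field_scale[OF K(1)] number_field_add[OF K(1)] by auto
  qed
  show "of_rat p + of_rat q * \<beta> + of_rat r * \<beta>^2 = of_rat p' + of_rat q' * \<beta> + of_rat r' * \<beta>^2 \<longleftrightarrow>
      p = p' \<and> q = q' \<and> r = r'" (is "?l \<longleftrightarrow> _")
  proof
    assume ?l
    then have "of_rat (p - p') * 1 + of_rat (q - q') * \<beta> + of_rat (r - r') * \<beta>^2 = 0"
      by (simp only: of_rat_diff) Groebner_Basis.algebra
    from ind[OF this] show "p = p' \<and> q = q' \<and> r = r'" by simp
  qed simp
qed

text \<open>Both fields have the powers 1, X, X^2 as a rational basis with the multiplication table
  of X^3 = Q X + N, which depends on Q and N alone. Matching coordinates is therefore an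
  isomorphism.\<close>

lemma field_iso_of_cubic_generators:
  fixes K :: "'a::field_char_0 set" and L :: "'b::field_char_0 set"
  assumes K: "number_field K" "field_degree K = 3"
    and \<beta>: "\<beta> \<in> K" "field_trace K \<beta> = 0" "\<beta> \<noteq> 0"
    and sq: "field_trace K (\<beta>^2) = 2 * of_int Q" and cube: "\<beta>^3 = of_int Q * \<beta> + of_int N"
    and L: "number_field L" "field_degree L = 3"
    and \<gamma>: "\<gamma> \<in> L" "field_trace L \<gamma> = 0" "\<gamma> \<noteq> 0"
    and sq': "field_trace L (\<gamma>^2) = 2 * of_int Q" and cube': "\<gamma>^3 = of_int Q * \<gamma> + of_int N"
  shows "\<exists>\<sigma>. field_iso K L \<sigma>"
proof -
  note BK = trace_zero_power_basis[OF K \<beta> sq cube] and BL = trace_zero_power_basis[OF L \<gamma> sq' cube']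
  define k where "k p q r = of_rat p + of_rat q * \<beta> + of_rat r * \<beta>^2" for p q r
  define l where "l p q r = of_rat p + of_rat q * \<gamma> + of_rat r * \<gamma>^2" for p q r
  have k: "x \<in> K \<longleftrightarrow> (\<exists>p q r. x = k p q r)" "k p q r = k p' q' r' \<longleftrightarrow> p = p' \<and> q = q' \<and> r = r'"
    for x p q r p' q' r' unfolding k_def using BK by blast+
  have l: "x \<in> L \<longleftrightarrow> (\<exists>p q r. x = l p q r)" "l p q r = l p' q' r' \<longleftrightarrow> p = p' \<and> q = q' \<and> r = r'"
    for x p q r p' q' r' unfolding l_def using BL by blast+
  have k_add: "k p q r + k p' q' r' = k (p + p') (q + q') (r + r')" for p q r p' q' r'
    unfolding k_def by (simp only: of_rat_add) Groebner_Basis.algebra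
  have l_add: "l p q r + l p' q' r' = l (p + p') (q + q') (r + r')" for p q r p' q' r'
    unfolding l_def by (simp only: of_rat_add) Groebner_Basis.algebra
  let ?P = "\<lambda>p q r p' q' r'. p*p' + of_int N * (q*r' + r*q')"
    and ?Q = "\<lambda>p q r p' q' r'. p*q' + q*p' + of_int Q * (q*r' + r*q') + of_int N * (r*r')"
    and ?R = "\<lambda>p q r p' q' r'. p*r' + r*p' + q*q' + of_int Q * (r*r')"
  have mult: "(p + q*x + r*x^2) * (p' + q'*x + r'*x^2) =
      (p*p' + n * (q*r' + r*q')) + (p*q' + q*p' + m * (q*r' + r*q') + n * (r*r')) * x
        + (p*r' + r*p' + q*q' + m * (r*r')) * x^2"
    if "x^3 = m * x + n" for p q r p' q' r' x m n :: "'c::field_char_0"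
    using that by Groebner_Basis.algebra
  have k_mult: "k p q r * k p' q' r' = k (?P p q r p' q' r') (?Q p q r p' q' r') (?R p q r p' q' r')"
    for p q r p' q' r'
    unfolding k_def mult[OF cube] by (simp only: of_rat_add of_rat_mult of_rat_of_int_eq)
  have l_mult: "l p q r * l p' q' r' = l (?P p q r p' q' r') (?Q p q r p' q' r') (?R p q r p' q' r')"
    for p q r p' q' r'
    unfolding l_def mult[OF cube'] by (simp only: of_rat_add of_rat_mult of_rat_of_int_eq)
  define \<sigma> where "\<sigma> x = (THE y. \<exists>p q r. x = k p q r \<and> y = l p q r)" for x
  have \<sigma>: "\<sigma> (k p q r) = l p q r" for p q r
    unfolding \<sigma>_def by (rule the_equality) (use k(2) in auto)
  have "bij_betw \<sigma> K L"
  proof (rule bij_betw_imageI)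
    show "inj_on \<sigma> K"
    proof (rule inj_onI)
      fix x y assume "x \<in> K" "y \<in> K" "\<sigma> x = \<sigma> y"
      then show "x = y" using k(1) l(2) \<sigma> by metis
    qed
    show "\<sigma> ` K = L"
    proof (intro equalityI subsetI)
      fix y assume "y \<in> \<sigma> ` K"
      then show "y \<in> L" using k(1) l(1) \<sigma> by (metis imageE)
    next
      fix y assume "y \<in> L"
      then obtain p q r where "y = \<sigma> (k p q r)" using l(1) \<sigma> by metis
      then show "y \<in> \<sigma> ` K" using k(1) by blast
    qed
  qed
  moreover have "\<sigma> 1 = 1" using \<sigma>[of 1 0 0] unfolding k_def l_def by simp
  moreover have "\<sigma> (x + y) = \<sigma> x + \<sigma> y \<and> \<sigma> (x * y) = \<sigma> x * \<sigma> y" if xy: "x \<in> K" "y \<in> K" for x y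
  proof -
    obtain p q r where x: "x = k p q r" using xy(1) k(1) by blast
    obtain p' q' r' where y: "y = k p' q' r'" using xy(2) k(1) by blast
    show ?thesis unfolding x y k_add k_mult \<sigma> l_add l_mult by simp
  qed
  ultimately show ?thesis unfolding field_iso_def by blast
qed

text \<open>Subtracting the normalised trace splits L into the rationals and the space of trace
  zero. A nonzero integer multiple of any trace zero element lies in the trace zero module, so that
  space has dimension two.\<close>

lemma field_degree_three_if_trace_zero_rank_two:
  assumes L: "number_field L"
    and T: "trace_zero_module L = {of_int x * g + of_int y * h | x y. True}"
    and indep: "\<And>x y. of_int x * g + of_int y * h = 0 \<Longrightarrow> x = 0 \<and> y = 0"
  shows "field_degree L = 3"
proof -
  let ?d = "of_nat (field_degree L) :: rat"
  have d0: "?d \<noteq> 0" using field_degree_pos[OF L] by simp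
  have "of_int 1 * g + of_int 0 * h \<in> trace_zero_module L" "of_int 0 * g + of_int 1 * h \<in> trace_zero_module L"
    unfolding T by blast+
  then have gh: "g \<in> L" "h \<in> L" "field_trace L g = 0" "field_trace L h = 0"
    unfolding trace_zero_module_def ring_of_integers_def by auto
  have one: "1 \<in> L" using number_field_one[OF L] .
  have ind: "p = 0 \<and> q = 0 \<and> r = 0" if eq: "of_rat p * 1 + of_rat q * g + of_rat r * h = 0" for p q r
  proof -
    have "field_trace L (of_rat p * 1 + of_rat q * g + of_rat r * h) = p * ?d"
      using gh one by (simp only: field_trace_add[OF L] field_trace_scale[OF L] number_field_add[OF L]
          number_field_scale[OF L] field_trace_one[OF L] mult_zero_right add_0_right)
    moreover have "field_trace L (0 :: 'a) = 0"
      using field_trace_scale[OF L one, of 0] by simp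
    ultimately have p: "p = 0" using eq d0 by simp
    obtain N where N: "N > 0" "\<forall>i\<in>{True, False}. \<exists>k. of_int N * (if i then q else r) = of_int k"
      using common_denominator[of "{True, False}" "\<lambda>i. if i then q else r"] by auto
    then obtain x y where xy: "of_int N * q = of_int x" "of_int N * r = of_int y" by auto
    have "of_int x * g + of_int y * h = of_rat (of_int N * q) * g + of_rat (of_int N * r) * h"
      unfolding xy by simp
    also have "\<dots> = of_int N * (of_rat p * 1 + of_rat q * g + of_rat r * h)"
      unfolding p by (simp only: of_rat_mult of_rat_of_int_eq of_rat_0) Groebner_Basis.algebra
    finally have "x = 0 \<and> y = 0" using indep eq by simp
    then show ?thesis using xy N(1) p by auto
  qed
  have "L \<subseteq> rat_vs.span {1, g, h}"
  proof
    fix x assume x: "x \<in> L"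
    define c where "c = field_trace L x / ?d"
    define z where "z = x + of_rat (- c) * 1"
    have z: "z \<in> L" unfolding z_def using x one number_field_add[OF L] number_field_scale[OF L] by blast
    have "field_trace L z = field_trace L x + (- c) * ?d"
      unfolding z_def using field_trace_add[OF L x number_field_scale[OF L one]] field_trace_scale[OF L one, of "- c"]
        field_trace_one[OF L] by simp
    then have tz: "field_trace L z = 0" unfolding c_def using d0 by simp
    obtain N :: int where N: "N > 0" "of_int N * z \<in> ring_of_integers L" using integral_multiple[OF L z] .
    have "field_trace L (of_int N * z) = 0" using field_trace_scale[OF L z, of "of_int N"] tz by simp
    then have "of_int N * z \<in> trace_zero_module L" using N(2) unfolding trace_zero_module_def by simp
    then obtain a b where ab: "of_int N * z = of_int a * g + of_int b * h" unfolding T by blast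
    have "of_rat (1 / of_int N) * (of_rat (of_int a) * g + of_rat (of_int b) * h) \<in> rat_vs.span {1, g, h}"
      by (intro rat_vs.span_scale rat_vs.span_add rat_vs.span_base) auto
    moreover have "z = of_rat (1 / of_int N) * (of_int N * z)" using N(1) by (simp add: of_rat_divide)
    ultimately have "z \<in> rat_vs.span {1, g, h}" using ab by simp
    then have "z + of_rat c * 1 \<in> rat_vs.span {1, g, h}"
      by (intro rat_vs.span_add rat_vs.span_scale) (auto intro: rat_vs.span_base)
    then show "x \<in> rat_vs.span {1, g, h}" unfolding z_def by (simp add: of_rat_minus)
  qed
  moreover have "{1, g, h} \<subseteq> L" using one gh by simp
  ultimately show ?thesis
    using rat_independent_three[of 1 g h, OF ind] rat_vs.basis_card_eq_dim[of "{1, g, h}" L]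
    unfolding field_degree_def by simp
qed

theorem theorem6p5:
  fixes K :: "'a::field_char_0 set" and L :: "'b::field_char_0 set"
  assumes "number_field K" and "field_degree K = 3"
    and "field_discr K > 0" and "fundamental_discr (field_discr K)"
    and "number_field L"
    and "\<exists>\<phi>. quadratic_module_iso (trace_zero_module K) (trace_form K)
               (trace_zero_module L) (trace_form L) \<phi>"
    and "\<not> 9 dvd field_discr L"
  shows "\<exists>\<sigma>. field_iso K L \<sigma>"
proof -
  note K = assms(1,2) and L = assms(5)
  have fund: "fundamental (field_discr K)"
  proof -
    obtain F :: "complex set" where F: "number_field F" "field_degree F = 2" "field_discr F = field_discr K"
      using assms(4) unfolding fundamental_discr_def by metis
    show ?thesis using quadratic_field_discr[OF F(1,2)] unfolding F(3) .
  qed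
  obtain w t a b c d where I: "index_form_basis K w t a b (3 * c) d" and b: "\<not> 3 dvd b"
  proof (rule adapted_basis_exists[OF K])
    \<comment> \<open>Stickelberger's congruence, visible in the index form: the discriminant is (b
      c + a d)^2 modulo 4. If it equals 9 E, then E has the same residue modulo 4, so E is a
      discriminant, and fundamentality would give 3^2 = 1.\<close>
    show "\<not> 9 dvd field_discr K"
    proof
      assume "9 dvd field_discr K"
      then obtain E where E: "field_discr K = 3^2 * E" by auto
      obtain w t a b c d where "index_form_basis K w t a b c d"
      proof -
        obtain bs where bs: "integral_basis K (1 # bs)" "Suc (length bs) = 3"
          using integral_basis_with_one[OF K(1)] K(2) by metis
        then obtain v0 t0 where "bs = [v0, t0]" by (auto simp: length_Suc_conv eval_nat_numeral)
        then show ?thesis using bs(1) index_form_basis_exists[OF K] that by metis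
      qed
      from index_form_discr[OF K this]
      have "field_discr K = (b*c + a*d)^2 - 4 * (a*c^3 + b^3*d + 7*a^2*d^2 - 4*a*b*c*d)"
        by (simp add: power2_eq_square algebra_simps)
      then have "E = (b*c + a*d)^2 + 4 * (- (a*c^3 + b^3*d + 7*a^2*d^2 - 4*a*b*c*d) - 2 * E)" using E by simp
      then have "E mod 4 = (b*c + a*d)^2 mod 4" by (metis mod_mult_self2)
      then have "E mod 4 = 0 \<or> E mod 4 = 1" using square_mod_4 by simp
      with fund[unfolded fundamental_def, THEN conjunct2, rule_format, OF E] have "(3 :: int)^2 = 1" .
      then show False by simp
    qed
  qed
  obtain \<phi> where \<phi>: "quadratic_module_iso (trace_zero_module K) (trace_form K)
      (trace_zero_module L) (trace_form L) \<phi>" using assms(6) by blast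
  let ?v = "trace_zero_vec w t b c"
  note TK = trace_zero_module_eq[OF K I b]
  have in_T: "?v x y \<in> trace_zero_module K" for x y unfolding TK by blast
  define g h where "g = \<phi> (?v 1 0)" and "h = \<phi> (?v 0 1)"
  have \<phi>_vec: "\<phi> (?v x y) = of_int x * g + of_int y * h" for x y
  proof -
    have "?v x y = of_int x * ?v 1 0 + of_int y * ?v 0 1" unfolding trace_zero_vec_def[OF K I] by simp
    moreover have "of_int x * ?v 1 0 = ?v x 0" "of_int y * ?v 0 1 = ?v 0 y"
      unfolding trace_zero_vec_def[OF K I] by simp_all
    ultimately show ?thesis
      using \<phi> in_T[of 1 0] in_T[of 0 1] in_T[of x 0] in_T[of 0 y]
      unfolding quadratic_module_iso_def g_def h_def by metis
  qed
  have bij: "bij_betw \<phi> (trace_zero_module K) (trace_zero_module L)"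
    using \<phi> unfolding quadratic_module_iso_def by blast
  have TL: "trace_zero_module L = {of_int x * g + of_int y * h | x y. True}"
    using bij_betw_imp_surj_on[OF bij, symmetric] unfolding TK \<phi>_vec[symmetric] by blast
  have indL: "x = 0 \<and> y = 0" if "of_int x * g + of_int y * h = 0" for x y
  proof -
    have "\<phi> (?v x y) = \<phi> (?v 0 0)" unfolding \<phi>_vec that by simp
    then have "?v x y = ?v 0 0" using bij_betw_imp_inj_on[OF bij] in_T by (metis inj_onD)
    then have "?v x y = 0" using trace_zero_vec_eq_0_iff[OF K I, of 0 0] by simp
    then show ?thesis using trace_zero_vec_eq_0_iff[OF K I] by simp
  qed
  have L3: "field_degree L = 3" using field_degree_three_if_trace_zero_rank_two[OF L TL indL] .
  note L = L L3
  obtain w' t' a' b' c' d' where I': "index_form_basis L w' t' a' b' (3 * c') d'" and b': "\<not> 3 dvd b'"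
    using adapted_basis_exists[OF L assms(7)] .
  let ?v' = "trace_zero_vec w' t' b' c'"
  note TL' = trace_zero_module_eq[OF L I' b']
  have v'_lin: "of_int m * ?v' x y + of_int n * ?v' z u = ?v' (m * x + n * z) (m * y + n * u)" for m n x y z u
    unfolding trace_zero_vec_def[OF L I']
    by (simp only: of_int_add of_int_mult) Groebner_Basis.algebra
  have v'_inj: "x = z \<and> y = u" if "?v' x y = ?v' z u" for x y z u
  proof -
    have "?v' (x - z) (y - u) = 0"
      using v'_lin[of 1 x y "-1" z u] that by simp
    then show ?thesis using trace_zero_vec_eq_0_iff[OF L I'] by simp
  qed
  have "g \<in> trace_zero_module L" "h \<in> trace_zero_module L"
    unfolding g_def h_def using in_T bij_betwE[OF bij] by blast+
  then obtain p r q s where g: "g = ?v' p r" and h: "h = ?v' q s" unfolding TL' by blast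
  have "?v' 1 0 \<in> trace_zero_module L" "?v' 0 1 \<in> trace_zero_module L" unfolding TL' by blast+
  then obtain p' r' q' s' where inv: "?v' 1 0 = of_int p' * g + of_int r' * h" "?v' 0 1 = of_int q' * g + of_int s' * h"
    unfolding TL by blast
  \<comment> \<open>The image of a basis is again a basis of the trace zero module of L; expressing
    the adapted basis through it gives an integral inverse matrix.\<close>
  have det: "(p*s - q*r)^2 = 1"
  proof -
    have "1 = p' * p + r' * q \<and> 0 = p' * r + r' * s" "0 = q' * p + s' * q \<and> 1 = q' * r + s' * s"
      using v'_inj inv unfolding g h v'_lin by blast+
    then have "(p*s - q*r) * (p'*s' - q'*r') = 1" by Groebner_Basis.algebra
    then have "p*s - q*r = 1 \<or> p*s - q*r = -1" by (metis zmult_eq_1_iff)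
    then show ?thesis by auto
  qed
  have \<phi>_v: "\<phi> (?v x y) = ?v' (x*p + y*q) (x*r + y*s)" for x y
    unfolding \<phi>_vec g h v'_lin ..
  have form: "half_trace_form a' b' c' d' (x*p + y*q) (x*r + y*s) = half_trace_form a b c d x y" for x y
  proof -
    have "trace_form L (\<phi> (?v x y)) = trace_form K (?v x y)"
      using \<phi> in_T unfolding quadratic_module_iso_def by blast
    then have "of_int (2 * half_trace_form a' b' c' d' (x*p + y*q) (x*r + y*s))
        = (of_int (2 * half_trace_form a b c d x y) :: rat)"
      unfolding \<phi>_v trace_form_trace_zero_vec[OF K I] trace_form_trace_zero_vec[OF L I'] .
    then have "2 * half_trace_form a' b' c' d' (x*p + y*q) (x*r + y*s) = 2 * half_trace_form a b c d x y"
      by (simp only: of_int_eq_iff)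
    then show ?thesis by simp
  qed
  define A B C A' B' C' where "A = b^2 - 9*a*c" and "B = b*c - 3*a*d" and "C = 3*c^2 - b*d"
    and "A' = b'^2 - 9*a'*c'" and "B' = b'*c' - 3*a'*d'" and "C' = 3*c'^2 - b'*d'"
  note defs = A_def B_def C_def A'_def B'_def C'_def
  \<comment> \<open>The value at (1, 1) is taken so that the mixed coefficient can be recovered by
    polarisation.\<close>
  have Q1: "3*A'*p^2 + 3*B'*p*r + C'*r^2 = 3*A" and Q3: "3*A'*q^2 + 3*B'*q*s + C'*s^2 = C"
    and Q11: "3*A'*(p + q)^2 + 3*B'*(p + q)*(r + s) + C'*(r + s)^2 = 3*A + 3*B + C"
    using form[of 1 0] form[of 0 1] form[of 1 1] unfolding half_trace_form_def defs[symmetric] by simp_all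
  have Q2: "6*A'*p*q + 3*B'*(p*s + q*r) + 2*C'*r*s = 3*B"
    using Q1 Q3 Q11 by Groebner_Basis.algebra
  have D: "field_discr K = 4*A*C - 3*B^2" "field_discr L = 4*A'*C' - 3*B'^2"
    unfolding defs using field_discr_trace_zero[OF K I] field_discr_trace_zero[OF L I'] .
  \<comment> \<open>The half trace form has discriminant -3 times that of the field, and a
    unimodular substitution preserves it.\<close>
  have DL: "field_discr L = field_discr K"
  proof -
    have "9 * field_discr K = (p*s - q*r)^2 * (9 * field_discr L)"
      unfolding D using Q1 Q2 Q3 by Groebner_Basis.algebra
    then show ?thesis using det by simp
  qed
  have "field_discr K \<noteq> 12" using cubic_discr_neq_12[OF L assms(7)] DL by simp
  from trace_zero_rigidity[OF D(1)[unfolded defs] b b' det Q1[unfolded defs] Q2[unfolded defs]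
      Q3[unfolded defs] fund assms(3) this]
  have F: "restricted_index_form a' b' c' d' p r ^ 2 = restricted_index_form a b c d 1 0 ^ 2"
    unfolding restricted_index_form_def by simp
  have Q: "half_trace_form a' b' c' d' p r = half_trace_form a b c d 1 0" using form[of 1 0] by simp
  have "norm_form a' b' c' d' p r ^ 2 = norm_form a b c d 1 0 ^ 2"
  proof -
    have "4 * half_trace_form a b c d 1 0 ^ 3 - 27 * norm_form a b c d 1 0 ^ 2
        = field_discr K * restricted_index_form a b c d 1 0 ^ 2"
      unfolding form_syzygy field_discr_trace_zero[OF K I] ..
    moreover have "4 * half_trace_form a' b' c' d' p r ^ 3 - 27 * norm_form a' b' c' d' p r ^ 2
        = field_discr L * restricted_index_form a' b' c' d' p r ^ 2"
      unfolding form_syzygy field_discr_trace_zero[OF L I'] ..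
    ultimately show ?thesis unfolding F Q DL by simp
  qed
  \<comment> \<open>The syzygy fixes the norm only up to sign. Negating the image vector flips the
    sign of its norm and keeps its half trace form, so a suitable sign gives the same cubic equation
    on both sides.\<close>
  then obtain \<epsilon> :: int where e: "norm_form a b c d 1 0 = \<epsilon> * norm_form a' b' c' d' p r" "\<epsilon> = 1 \<or> \<epsilon> = -1"
    by (metis mult_1 mult_minus1 power2_eq_iff)
  let ?\<beta> = "?v 1 0" and ?\<gamma> = "?v' (\<epsilon> * p) (\<epsilon> * r)"
  have e2: "half_trace_form a' b' c' d' (\<epsilon> * p) (\<epsilon> * r) = half_trace_form a b c d 1 0"
  proof -
    have "half_trace_form a' b' c' d' (\<epsilon> * p) (\<epsilon> * r) = half_trace_form a' b' c' d' p r"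
      unfolding half_trace_form_def using e(2) by auto
    then show ?thesis using Q by simp
  qed
  have e3: "norm_form a' b' c' d' (\<epsilon> * p) (\<epsilon> * r) = norm_form a b c d 1 0"
  proof -
    have "norm_form a' b' c' d' (\<epsilon> * p) (\<epsilon> * r) = \<epsilon> * norm_form a' b' c' d' p r"
      unfolding norm_form_def using e(2) by auto
    then show ?thesis using e(1) by simp
  qed
  have pr: "\<epsilon> * p \<noteq> 0 \<or> \<epsilon> * r \<noteq> 0"
  proof -
    have "p \<noteq> 0 \<or> r \<noteq> 0" using det by auto
    then show ?thesis using e(2) by auto
  qed
  show ?thesis
  proof (rule field_iso_of_cubic_generators[OF K _ _ _ _ _ L])
    show "?\<beta> \<in> K" "field_trace K ?\<beta> = 0" using trace_zero_vec_props[OF K I] by blast+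
    show "?\<gamma> \<in> L" "field_trace L ?\<gamma> = 0" using trace_zero_vec_props[OF L I'] by blast+
    show "?\<beta> \<noteq> 0" using trace_zero_vec_eq_0_iff[OF K I, of 1 0] by simp
    show "?\<gamma> \<noteq> 0" using trace_zero_vec_eq_0_iff[OF L I'] pr by simp
    show "field_trace K (?\<beta>^2) = 2 * of_int (half_trace_form a b c d 1 0)"
      using trace_form_trace_zero_vec[OF K I, of 1 0] unfolding trace_form_def by simp
    show "field_trace L (?\<gamma>^2) = 2 * of_int (half_trace_form a b c d 1 0)"
      using trace_form_trace_zero_vec[OF L I', of "\<epsilon> * p" "\<epsilon> * r"] unfolding trace_form_def e2 by simp
    show "?\<beta>^3 = of_int (half_trace_form a b c d 1 0) * ?\<beta> + of_int (norm_form a b c d 1 0)"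
      by (rule trace_zero_vec_cube[OF K I])
    show "?\<gamma>^3 = of_int (half_trace_form a b c d 1 0) * ?\<gamma> + of_int (norm_form a b c d 1 0)"
      using trace_zero_vec_cube[OF L I', of "\<epsilon> * p" "\<epsilon> * r"] unfolding e2 e3 .
  qed
qed

end
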